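(* (i) Any $\mathbb{N}$-graded ring is semi-graded (SG). (ii) Let $K$ be a field. Any finitely graded $K$-algebra is a finitely semi-graded (FSG) ring. (iii) Any skew $PBW$ extension $A=\sigma(R)\langle x_1,\dots,x_n\rangle$ of a ring $R$ with invariant basis number is an FSG ring.
   Context: All rings are unital and not necessarily commutative; modules are left modules. A ring $B$ is semi-graded (SG) if there is a collection $\{B_n\}_{n\ge 0}$ of subgroups of the additive group of $B$ such that: $B=\bigoplus_{n\ge0}B_n$; $B_mB_n\subseteq B_0\oplus\cdots\oplus B_{m+n}$ for all $m,n\ge 0$; and $1\in B_0$. A ring $B$ is finitely semi-graded (FSG) if $B$ is SG, there are finitely many elements $x_1,\dots,x_n\in B$ such that the subring generated by $B_0$ and $x_1,\dots,x_n$ is $B$, and for every $n\ge 0$, $B_n$ is a free (left) $B_0$-module of finite dimension. A $K$-algebra $A$ over a field $K$ is finitely graded if $A=\bigoplus_{n\ge0}A_n$ is $\mathbb{N}$-graded, connected ($A_0=K$), and finitely generated as a $K$-algebra. Let $R$ and $A$ be rings. $A$ is a skew $PBW$ extension of $R$, written $A=\sigma(R)\langle x_1,\dots,x_n\rangle$, if: (1) $R\subseteq A$ (subring); (2) there are finitely many elements $x_1,\dots,x_n\in A$ such that $A$ is a free left $R$-module with basis $\mathrm{Mon}(A)=\{x^\alpha=x_1^{\alpha_1}\cdots x_n^{\alpha_n}\mid \alpha=(\alpha_1,\dots,\alpha_n)\in\mathbb{N}^n\}$, $\mathbb{N}=\{0,1,2,\dots\}$; (3) for every $1\le i\le n$ and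 $r\in R-\{0\}$ there is $c_{i,r}\in R-\{0\}$ with $x_ir-c_{i,r}x_i\in R$; (4) for every $1\le i,j\le n$ there is $c_{i,j}\in R-\{0\}$ with $x_jx_i-c_{i,j}x_ix_j\in R+Rx_1+\cdots+Rx_n$. The semi-graduation of a skew $PBW$ extension is $A=\bigoplus_{k\ge0}A_k$, where $A_k$ is the left $R$-submodule generated by the monomials $x^\alpha\in\mathrm{Mon}(A)$ with $\alpha_1+\cdots+\alpha_n=k$. *)

theory Defs
  imports "HOL-Algebra.Generated_Rings" "HOL-Algebra.Module"
begin

section \<open>Left modules over not necessarily commutative rings\<close>

text \<open>The library locale \<^locale>\<open>module\<close> requires a commutative base ring; its module axioms proper,
  \<^const>\<open>module_axioms\<close>, do not depend on commutativity.\<close>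

definition left_module ::
    "('a, 'r) ring_scheme \<Rightarrow> ('a, 'b, 'm) module_scheme \<Rightarrow> bool" where
  "left_module R M \<longleftrightarrow> ring R \<and> abelian_group M \<and> module_axioms R M"

text \<open>Families rather than sets, so that repeated vectors make a family dependent
  (over a nonzero ring).\<close>

definition basis_family ::
    "('a, 'r) ring_scheme \<Rightarrow> ('a, 'b, 'm) module_scheme \<Rightarrow> 'i set \<Rightarrow> ('i \<Rightarrow> 'b) \<Rightarrow> bool" where
  "basis_family R M I e \<longleftrightarrow>
     e \<in> I \<rightarrow> carrier M \<and>
     (\<forall>v\<in>carrier M. \<exists>J c. finite J \<and> J \<subseteq> I \<and> c \<in> J \<rightarrow> carrier R \<and>
        v = (\<Oplus>\<^bsub>M\<^esub>i\<in>J. c i \<odot>\<^bsub>M\<^esub> e i)) \<and>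
     (\<forall>J c. finite J \<and> J \<subseteq> I \<and> c \<in> J \<rightarrow> carrier R \<and>
        (\<Oplus>\<^bsub>M\<^esub>i\<in>J. c i \<odot>\<^bsub>M\<^esub> e i) = \<zero>\<^bsub>M\<^esub> \<longrightarrow> (\<forall>i\<in>J. c i = \<zero>\<^bsub>R\<^esub>))"

definition is_basis ::
    "('a, 'r) ring_scheme \<Rightarrow> ('a, 'b, 'm) module_scheme \<Rightarrow> 'b set \<Rightarrow> bool" where
  "is_basis R M S \<longleftrightarrow> basis_family R M S (\<lambda>v. v)"

text \<open>A free module has dimension \<open>d\<close> if it has a basis with \<open>d\<close> elements and the dimension is
  well defined, i.e. every other basis has \<open>d\<close> elements as well; over a ring without invariant
  basis number the last condition is not automatic.\<close>

definition free_of_dim ::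
    "('a, 'r) ring_scheme \<Rightarrow> ('a, 'b, 'm) module_scheme \<Rightarrow> nat \<Rightarrow> bool" where
  "free_of_dim R M d \<longleftrightarrow> left_module R M \<and>
     (\<exists>S. is_basis R M S) \<and>
     (\<forall>S. is_basis R M S \<longrightarrow> finite S \<and> card S = d)"

text \<open>In the two module records below the fields \<open>mult\<close> and \<open>one\<close> are required by the record type,
  but are irrelevant for the module structure.\<close>

definition free_module :: "('a, 'r) ring_scheme \<Rightarrow> nat \<Rightarrow> ('a, nat \<Rightarrow> 'a) module" where
  "free_module R n =
     \<lparr>carrier = {..<n} \<rightarrow>\<^sub>E carrier R,
      monoid.mult = (\<lambda>v w. \<lambda>i\<in>{..<n}. v i \<otimes>\<^bsub>R\<^esub> w i),
      one = (\<lambda>i\<in>{..<n}. \<one>\<^bsub>R\<^esub>),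
      zero = (\<lambda>i\<in>{..<n}. \<zero>\<^bsub>R\<^esub>),
      add = (\<lambda>v w. \<lambda>i\<in>{..<n}. v i \<oplus>\<^bsub>R\<^esub> w i),
      smult = (\<lambda>r v. \<lambda>i\<in>{..<n}. r \<otimes>\<^bsub>R\<^esub> v i)\<rparr>"

definition left_module_iso ::
    "('a, 'r) ring_scheme \<Rightarrow> ('a, 'b, 'm) module_scheme \<Rightarrow> ('a, 'c, 'n) module_scheme
      \<Rightarrow> ('b \<Rightarrow> 'c) set" where
  "left_module_iso R M N =
     {f. bij_betw f (carrier M) (carrier N) \<and>
         (\<forall>v\<in>carrier M. \<forall>w\<in>carrier M. f (v \<oplus>\<^bsub>M\<^esub> w) = f v \<oplus>\<^bsub>N\<^esub> f w) \<and>
         (\<forall>r\<in>carrier R. \<forall>v\<in>carrier M. f (r \<odot>\<^bsub>M\<^esub> v) = r \<odot>\<^bsub>N\<^esub> f v)}"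

definition invariant_basis_number :: "('a, 'r) ring_scheme \<Rightarrow> bool" where
  "invariant_basis_number R \<longleftrightarrow>
     (\<forall>m n. left_module_iso R (free_module R m) (free_module R n) \<noteq> {} \<longrightarrow> m = n)"

text \<open>An additive subgroup \<open>V\<close> of a ring \<open>A\<close> with scalars from \<open>A\<close> acting by left
  multiplication.\<close>

definition mult_module :: "('a, 'r) ring_scheme \<Rightarrow> 'a set \<Rightarrow> ('a, 'a) module" where
  "mult_module A V =
     \<lparr>carrier = V, monoid.mult = monoid.mult A, one = one A,
      zero = zero A, add = add A, smult = monoid.mult A\<rparr>"


section \<open>Graded and semi-graded rings\<close>

definition internal_direct_sum :: "('a, 'r) ring_scheme \<Rightarrow> (nat \<Rightarrow> 'a set) \<Rightarrow> bool" where
  "internal_direct_sum A B \<longleftrightarrow>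
     (\<forall>n. additive_subgroup (B n) A) \<and>
     (\<forall>a\<in>carrier A. \<exists>!f. (\<forall>n. f n \<in> B n) \<and> finite {n. f n \<noteq> \<zero>\<^bsub>A\<^esub>} \<and>
        a = (\<Oplus>\<^bsub>A\<^esub>n\<in>{n. f n \<noteq> \<zero>\<^bsub>A\<^esub>}. f n))"

definition sum_upto :: "('a, 'r) ring_scheme \<Rightarrow> (nat \<Rightarrow> 'a set) \<Rightarrow> nat \<Rightarrow> 'a set" where
  "sum_upto A B k = {(\<Oplus>\<^bsub>A\<^esub>i\<in>{..k}. f i) | f. f \<in> (\<Pi> i\<in>{..k}. B i)}"

definition graded_ring :: "('a, 'r) ring_scheme \<Rightarrow> (nat \<Rightarrow> 'a set) \<Rightarrow> bool" where
  "graded_ring A B \<longleftrightarrow> ring A \<and> internal_direct_sum A B \<and>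
     (\<forall>m n. B m <#>\<^bsub>A\<^esub> B n \<subseteq> B (m + n))"

text \<open>The semi-graduation is an explicit argument: with it existentially quantified the notions
  would be (nearly) vacuous, since every ring is semi-graded by \<open>B\<^sub>0 = A\<close> and
  \<open>B\<^sub>n = 0\<close> for \<open>n > 0\<close>.\<close>

definition semi_graded :: "('a, 'r) ring_scheme \<Rightarrow> (nat \<Rightarrow> 'a set) \<Rightarrow> bool" where
  "semi_graded A B \<longleftrightarrow> ring A \<and> internal_direct_sum A B \<and>
     (\<forall>m n. B m <#>\<^bsub>A\<^esub> B n \<subseteq> sum_upto A B (m + n)) \<and>
     \<one>\<^bsub>A\<^esub> \<in> B 0"

text \<open>That \<open>B n\<close> is a \<open>B 0\<close>-module includes \<open>B 0 B n \<subseteq> B n\<close>, which does not follow from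
  \<^const>\<open>semi_graded\<close>.\<close>

definition finitely_semi_graded :: "('a, 'r) ring_scheme \<Rightarrow> (nat \<Rightarrow> 'a set) \<Rightarrow> bool" where
  "finitely_semi_graded A B \<longleftrightarrow> semi_graded A B \<and>
     (\<exists>X. finite X \<and> X \<subseteq> carrier A \<and> generate_ring A (B 0 \<union> X) = carrier A) \<and>
     (\<forall>n. \<exists>d. free_of_dim (A\<lparr>carrier := B 0\<rparr>) (mult_module A (B n)) d)"

text \<open>\<open>K\<close> is a subfield of \<open>A\<close>, and \<open>A\<close> is a \<open>K\<close>-algebra because \<open>K\<close> is central. The \<open>K\<close>-subalgebra
  generated by \<open>X\<close> is the subring generated by \<open>K \<union> X\<close>.\<close>

definition finitely_graded_algebra ::
    "'a set \<Rightarrow> ('a, 'r) ring_scheme \<Rightarrow> (nat \<Rightarrow> 'a set) \<Rightarrow> bool" where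
  "finitely_graded_algebra K A B \<longleftrightarrow> ring A \<and> subfield K A \<and>
     (\<forall>k\<in>K. \<forall>a\<in>carrier A. k \<otimes>\<^bsub>A\<^esub> a = a \<otimes>\<^bsub>A\<^esub> k) \<and>
     graded_ring A B \<and> B 0 = K \<and>
     (\<exists>X. finite X \<and> X \<subseteq> carrier A \<and> generate_ring A (K \<union> X) = carrier A)"


section \<open>Skew PBW extensions\<close>

definition exponents :: "nat \<Rightarrow> (nat \<Rightarrow> nat) set" where
  "exponents n = {1..n} \<rightarrow>\<^sub>E UNIV"

text \<open>\<open>x\<^sub>1\<^bsup>\<alpha>\<^sub>1\<^esup> \<cdots> x\<^sub>n\<^bsup>\<alpha>\<^sub>n\<^esup>\<close>, in this order.\<close>

definition monomial ::
    "('a, 'r) ring_scheme \<Rightarrow> nat \<Rightarrow> (nat \<Rightarrow> 'a) \<Rightarrow> (nat \<Rightarrow> nat) \<Rightarrow> 'a" where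
  "monomial A n x \<alpha> =
     foldr (\<lambda>i m. (x i [^]\<^bsub>A\<^esub> \<alpha> i) \<otimes>\<^bsub>A\<^esub> m) [1..<Suc n] \<one>\<^bsub>A\<^esub>"

definition skew_PBW_extension ::
    "('a, 'r) ring_scheme \<Rightarrow> 'a set \<Rightarrow> nat \<Rightarrow> (nat \<Rightarrow> 'a) \<Rightarrow> bool" where
  "skew_PBW_extension A R n x \<longleftrightarrow> ring A \<and> subring R A \<and>
     x \<in> {1..n} \<rightarrow> carrier A \<and>
     basis_family (A\<lparr>carrier := R\<rparr>) (mult_module A (carrier A)) (exponents n) (monomial A n x) \<and>
     (\<forall>i\<in>{1..n}. \<forall>r\<in>R - {\<zero>\<^bsub>A\<^esub>}. \<exists>c\<in>R - {\<zero>\<^bsub>A\<^esub>}.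
        x i \<otimes>\<^bsub>A\<^esub> r \<ominus>\<^bsub>A\<^esub> c \<otimes>\<^bsub>A\<^esub> x i \<in> R) \<and>
     (\<forall>i\<in>{1..n}. \<forall>j\<in>{1..n}. \<exists>c\<in>R - {\<zero>\<^bsub>A\<^esub>}. \<exists>r0\<in>R. \<exists>r\<in>{1..n} \<rightarrow> R.
        x j \<otimes>\<^bsub>A\<^esub> x i \<ominus>\<^bsub>A\<^esub> c \<otimes>\<^bsub>A\<^esub> x i \<otimes>\<^bsub>A\<^esub> x j =
          r0 \<oplus>\<^bsub>A\<^esub> (\<Oplus>\<^bsub>A\<^esub>k\<in>{1..n}. r k \<otimes>\<^bsub>A\<^esub> x k))"

definition PBW_component ::
    "('a, 'r) ring_scheme \<Rightarrow> 'a set \<Rightarrow> nat \<Rightarrow> (nat \<Rightarrow> 'a) \<Rightarrow> nat \<Rightarrow> 'a set" where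
  "PBW_component A R n x k =
     {(\<Oplus>\<^bsub>A\<^esub>\<alpha>\<in>J. c \<alpha> \<otimes>\<^bsub>A\<^esub> monomial A n x \<alpha>) | J c.
        finite J \<and> J \<subseteq> {\<alpha> \<in> exponents n. (\<Sum>i\<in>{1..n}. \<alpha> i) = k} \<and> c \<in> J \<rightarrow> R}"

end

theory Submission
  imports Defs "HOL-Algebra.Embedded_Algebras" "HOL-Library.Multiset"
begin

text \<open>
  All modules in question are additive subgroups \<open>V\<close> of a ring on which a subring \<open>K\<close>
  acts by left multiplication. They are studied inside the ring, as left spans over \<open>K\<close> of families
  of ring elements.

  \<^bold>\<open>Graded rings.\<close> The component of degree \<open>0\<close> of the unit acts as a right
  unit on homogeneous elements, as a comparison of degrees shows, hence it equals the unit
  (\<open>graded_ring_one\<close>). The rest of the definition of a semi-graded ring is immediate.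

  \<^bold>\<open>Finitely graded algebras.\<close> Words in the homogeneous components of positive degree of
  the generators span the algebra over the central field \<open>K\<close>. By uniqueness of homogeneous
  decompositions (\<open>homogeneous_part\<close>) the words of degree \<open>n\<close> span the component of
  degree \<open>n\<close>. There are finitely many of them, so that component has a finite dimension over
  \<open>K\<close> (\<open>free_of_dim_subfield\<close>).

  \<^bold>\<open>Skew PBW extensions.\<close> Grouping the basis of monomials by degree splits the ring into
  the components of the semi-graduation (\<open>left_span_grading\<close>). A component is free on the finitely
  many monomials of its degree, and invariant basis number makes their number the size of every basis
  (\<open>free_of_dim_invariant_basis_number\<close>). The substantial point is that the product of monomials of
  degrees \<open>k\<close> and \<open>l\<close> involves only monomials of degree at most
  \<open>k + l\<close>. Moving a variable past a scalar or past another variable costs a coefficient and terms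
  of lower degree, so inserting a variable into a monomial at its proper place again costs only a coefficient
  and such terms (\<open>insertion_law_sorted_words\<close>). Applying this to one variable after the other
  bounds the product (\<open>filtration_mult\<close>).
\<close>

section \<open>Finite sums in a ring\<close>

context ring
begin

lemma finsum_mem:
  assumes "\<zero> \<in> H" "\<And>a b. \<lbrakk>a \<in> H; b \<in> H\<rbrakk> \<Longrightarrow> a \<oplus> b \<in> H" "H \<subseteq> carrier R" "f \<in> J \<rightarrow> H"
  shows "(\<Oplus>i\<in>J. f i) \<in> H"
  using assms(4)
proof (induction J rule: infinite_finite_induct)
  case (insert x F)
  then have "f \<in> F \<rightarrow> carrier R" "f x \<in> carrier R" using assms(3) by auto
  then show ?case using insert assms(2) by simp
qed (use assms in auto)

lemma finsum_extend:
  assumes "finite J" "J' \<subseteq> J" "f \<in> J' \<rightarrow> carrier R"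
  shows "(\<Oplus>i\<in>J'. f i) = (\<Oplus>i\<in>J. if i \<in> J' then f i else \<zero>)"
  by (rule add.finprod_mono_neutral_cong_left) (use assms in \<open>auto simp: Pi_iff\<close>)

lemma finsum_uminus:
  assumes "f \<in> J \<rightarrow> carrier R"
  shows "\<ominus> (\<Oplus>i\<in>J. f i) = (\<Oplus>i\<in>J. \<ominus> f i)"
  using assms
proof (induction J rule: infinite_finite_induct)
  case (insert x F)
  then have "f \<in> F \<rightarrow> carrier R" "f x \<in> carrier R" by auto
  then show ?case using insert by (simp add: Pi_iff minus_add)
qed auto

lemma finsum_minus:
  assumes "f \<in> J \<rightarrow> carrier R" "g \<in> J \<rightarrow> carrier R"
  shows "(\<Oplus>i\<in>J. f i \<ominus> g i) = (\<Oplus>i\<in>J. f i) \<ominus> (\<Oplus>i\<in>J. g i)"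
proof -
  have "(\<Oplus>i\<in>J. f i \<oplus> \<ominus> g i) = (\<Oplus>i\<in>J. f i) \<oplus> (\<Oplus>i\<in>J. \<ominus> g i)"
    by (rule finsum_addf) (use assms in auto)
  then show ?thesis by (simp only: a_minus_def finsum_uminus[OF assms(2)])
qed

lemma finsum_fibres:
  assumes "finite J" "f \<in> J \<rightarrow> carrier R"
  shows "(\<Oplus>j\<in>J. f j) = (\<Oplus>n\<in>wt ` J. \<Oplus>j\<in>{j \<in> J. wt j = n}. f j)"
proof -
  have "(\<Oplus>j\<in>\<Union>((\<lambda>n. {j \<in> J. wt j = n}) ` wt ` J). f j)
      = (\<Oplus>n\<in>wt ` J. \<Oplus>j\<in>{j \<in> J. wt j = n}. f j)"
    by (rule add.finprod_UN_disjoint)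
      (use assms in \<open>auto simp: pairwise_def disjnt_def\<close>)
  moreover have "\<Union>((\<lambda>n. {j \<in> J. wt j = n}) ` wt ` J) = J" by auto
  ultimately show ?thesis by simp
qed

lemma additive_subgroupE:
  assumes "additive_subgroup V R"
  shows "V \<subseteq> carrier R" "\<zero> \<in> V" "\<And>a b. \<lbrakk>a \<in> V; b \<in> V\<rbrakk> \<Longrightarrow> a \<oplus> b \<in> V" "\<And>a. a \<in> V \<Longrightarrow> \<ominus> a \<in> V"
proof -
  interpret additive_subgroup V R by fact
  show "V \<subseteq> carrier R" by (rule a_subset)
  show "\<zero> \<in> V" "\<And>a b. \<lbrakk>a \<in> V; b \<in> V\<rbrakk> \<Longrightarrow> a \<oplus> b \<in> V" by auto
  show "\<ominus> a \<in> V" if "a \<in> V" for a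
    by (rule a_inv_closed) (use that abelian_group_axioms in auto)
qed

end


section \<open>Left spans and independent families\<close>

definition (in ring) left_span :: "'a set \<Rightarrow> 'i set \<Rightarrow> ('i \<Rightarrow> 'a) \<Rightarrow> 'a set" where
  "left_span K I e = {(\<Oplus>i\<in>J. c i \<otimes> e i) | J c. finite J \<and> J \<subseteq> I \<and> c \<in> J \<rightarrow> K}"

definition (in ring) left_independent :: "'a set \<Rightarrow> 'i set \<Rightarrow> ('i \<Rightarrow> 'a) \<Rightarrow> bool" where
  "left_independent K I e \<longleftrightarrow>
     (\<forall>J c. finite J \<and> J \<subseteq> I \<and> c \<in> J \<rightarrow> K \<and> (\<Oplus>i\<in>J. c i \<otimes> e i) = \<zero> \<longrightarrow> (\<forall>i\<in>J. c i = \<zero>))"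

context ring
begin

lemma left_span_iff:
  "v \<in> left_span K I e \<longleftrightarrow>
    (\<exists>J c. finite J \<and> J \<subseteq> I \<and> c \<in> J \<rightarrow> K \<and> v = (\<Oplus>i\<in>J. c i \<otimes> e i))"
  by (auto simp: left_span_def)

lemma left_spanE:
  assumes "v \<in> left_span K I e"
  obtains J c where "finite J" "J \<subseteq> I" "c \<in> J \<rightarrow> K" "v = (\<Oplus>i\<in>J. c i \<otimes> e i)"
  using assms unfolding left_span_iff by blast

lemma left_span_mem:
  assumes "finite J" "J \<subseteq> I" "c \<in> J \<rightarrow> K"
  shows "(\<Oplus>i\<in>J. c i \<otimes> e i) \<in> left_span K I e"
  using assms unfolding left_span_def by blast

lemma left_span_mono: "I \<subseteq> I' \<Longrightarrow> left_span K I e \<subseteq> left_span K I' e"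
  unfolding left_span_def by blast

lemma left_span_zero: "\<zero> \<in> left_span K I e"
  using left_span_mem[of "{}"] by simp

text \<open>The induction principle for left spans. Closure of spans under multiplication is proved later by
  taking for \<open>H\<close> the set of those elements whose product with a given element lies in the
  target.\<close>
lemma left_span_minimal:
  assumes "\<zero> \<in> H" "\<And>a b. \<lbrakk>a \<in> H; b \<in> H\<rbrakk> \<Longrightarrow> a \<oplus> b \<in> H" "H \<subseteq> carrier R"
    and "\<And>i k. \<lbrakk>i \<in> I; k \<in> K\<rbrakk> \<Longrightarrow> k \<otimes> e i \<in> H"
  shows "left_span K I e \<subseteq> H"
proof -
  have "(\<Oplus>i\<in>J. c i \<otimes> e i) \<in> H" if "J \<subseteq> I" "c \<in> J \<rightarrow> K" for J c
  proof (rule finsum_mem)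
    show "(\<lambda>i. c i \<otimes> e i) \<in> J \<rightarrow> H" using that assms(4) by (auto dest: Pi_mem)
  qed (use assms in auto)
  then show ?thesis by (auto simp: left_span_def)
qed

lemma left_independentD:
  assumes "left_independent K I e" "finite J" "J \<subseteq> I" "c \<in> J \<rightarrow> K" "(\<Oplus>i\<in>J. c i \<otimes> e i) = \<zero>" "i \<in> J"
  shows "c i = \<zero>"
  using assms unfolding left_independent_def by blast

context
  fixes K assumes K: "subring K R"
begin

private lemmas K_simps [simp, intro] = subringE(2,3,5-7)[OF K] subringE(1)[OF K, THEN subsetD]

lemma left_span_carrier:
  assumes "e \<in> I \<rightarrow> carrier R"
  shows "left_span K I e \<subseteq> carrier R"
proof -
  have "(\<Oplus>i\<in>J. c i \<otimes> e i) \<in> carrier R" if "J \<subseteq> I" "c \<in> J \<rightarrow> K" for J c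
    by (rule finsum_closed) (use that assms in auto)
  then show ?thesis by (auto simp: left_span_def)
qed

lemma left_span_generator:
  assumes "e \<in> I \<rightarrow> carrier R" "i \<in> I" "k \<in> K"
  shows "k \<otimes> e i \<in> left_span K I e"
proof -
  have "e i \<in> carrier R" using assms by auto
  then show ?thesis using left_span_mem[of "{i}" I "\<lambda>_. k" K e] assms by simp
qed

lemma left_span_incl:
  assumes "e \<in> I \<rightarrow> carrier R" "i \<in> I"
  shows "e i \<in> left_span K I e"
  using left_span_generator[OF assms, of \<one>] Pi_mem[OF assms] by simp

lemma left_span_smult:
  assumes "e \<in> I \<rightarrow> carrier R" "k \<in> K" "v \<in> left_span K I e"
  shows "k \<otimes> v \<in> left_span K I e"
proof -
  obtain J c where J: "finite J" "J \<subseteq> I" "c \<in> J \<rightarrow> K" and v: "v = (\<Oplus>i\<in>J. c i \<otimes> e i)"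
    using left_spanE[OF assms(3)] .
  have e: "e i \<in> carrier R" if "i \<in> J" for i using that J assms(1) by auto
  have c: "c i \<in> K" if "i \<in> J" for i using that J by auto
  have "k \<otimes> v = (\<Oplus>i\<in>J. k \<otimes> (c i \<otimes> e i))"
    unfolding v by (rule finsum_rdistr) (use J assms e c in auto)
  also have "\<dots> = (\<Oplus>i\<in>J. (k \<otimes> c i) \<otimes> e i)"
    by (rule finsum_cong') (use assms c e in \<open>auto simp: m_assoc\<close>)
  finally show ?thesis using left_span_mem[of J I "\<lambda>i. k \<otimes> c i"] J assms c by auto
qed

lemma left_span_finite:
  assumes "finite I" "e \<in> I \<rightarrow> carrier R"
  shows "left_span K I e = {(\<Oplus>i\<in>I. c i \<otimes> e i) | c. c \<in> I \<rightarrow> K}"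
proof -
  have *: "\<exists>d. (\<Oplus>i\<in>J. c i \<otimes> e i) = (\<Oplus>i\<in>I. d i \<otimes> e i) \<and> d \<in> I \<rightarrow> K"
    if J: "J \<subseteq> I" "c \<in> J \<rightarrow> K" for J c
  proof (intro exI conjI)
    have mem: "c i \<in> carrier R" "e i \<in> carrier R" if "i \<in> J" for i
      using that J assms(2) by (auto dest: Pi_mem)
    let ?d = "\<lambda>i. if i \<in> J then c i else \<zero>"
    have "(\<Oplus>i\<in>J. c i \<otimes> e i) = (\<Oplus>i\<in>I. if i \<in> J then c i \<otimes> e i else \<zero>)"
      by (rule finsum_extend) (use assms(1) J(1) mem in auto)
    also have "\<dots> = (\<Oplus>i\<in>I. ?d i \<otimes> e i)"
      by (rule finsum_cong') (use assms(2) mem in \<open>auto dest: Pi_mem\<close>)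
    finally show "(\<Oplus>i\<in>J. c i \<otimes> e i) = (\<Oplus>i\<in>I. ?d i \<otimes> e i)" .
    show "?d \<in> I \<rightarrow> K" using J by auto
  qed
  show ?thesis
  proof
    show "left_span K I e \<subseteq> {(\<Oplus>i\<in>I. c i \<otimes> e i) | c. c \<in> I \<rightarrow> K}"
      unfolding left_span_def using * by blast
    show "{(\<Oplus>i\<in>I. c i \<otimes> e i) | c. c \<in> I \<rightarrow> K} \<subseteq> left_span K I e"
      unfolding left_span_def using assms(1) by blast
  qed
qed

lemma left_span_add:
  assumes "e \<in> I \<rightarrow> carrier R" "v \<in> left_span K I e" "w \<in> left_span K I e"
  shows "v \<oplus> w \<in> left_span K I e"
proof -
  obtain J c where J: "finite J" "J \<subseteq> I" "c \<in> J \<rightarrow> K" and v: "v = (\<Oplus>i\<in>J. c i \<otimes> e i)"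
    using left_spanE[OF assms(2)] .
  obtain J' c' where J': "finite J'" "J' \<subseteq> I" "c' \<in> J' \<rightarrow> K" and w: "w = (\<Oplus>i\<in>J'. c' i \<otimes> e i)"
    using left_spanE[OF assms(3)] .
  let ?U = "J \<union> J'"
  have U: "finite ?U" "e \<in> ?U \<rightarrow> carrier R" using J J' assms(1) by auto
  have "v \<in> left_span K ?U e" "w \<in> left_span K ?U e"
    unfolding v w using J J' by (auto intro!: left_span_mem)
  then obtain a b where a: "a \<in> ?U \<rightarrow> K" "v = (\<Oplus>i\<in>?U. a i \<otimes> e i)"
    and b: "b \<in> ?U \<rightarrow> K" "w = (\<Oplus>i\<in>?U. b i \<otimes> e i)"
    unfolding left_span_finite[OF U] by blast
  have mem: "a i \<in> carrier R" "b i \<in> carrier R" "e i \<in> carrier R" if "i \<in> ?U" for i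
    using that a(1) b(1) U(2) by auto
  have "v \<oplus> w = (\<Oplus>i\<in>?U. a i \<otimes> e i \<oplus> b i \<otimes> e i)"
    unfolding a b by (rule finsum_addf[symmetric]) (use mem in auto)
  also have "\<dots> = (\<Oplus>i\<in>?U. (a i \<oplus> b i) \<otimes> e i)"
    by (rule finsum_cong') (use mem in \<open>auto simp: l_distr\<close>)
  also have "\<dots> \<in> left_span K I e"
    by (rule left_span_mem) (use a(1) b(1) J J' in auto)
  finally show ?thesis .
qed

lemma left_span_additive_subgroup:
  assumes "e \<in> I \<rightarrow> carrier R"
  shows "additive_subgroup (left_span K I e) R"
proof (intro additive_subgroupI add.subgroupI)
  show "\<ominus> v \<in> left_span K I e" if "v \<in> left_span K I e" for v
  proof -
    have "\<ominus> v = (\<ominus> \<one>) \<otimes> v"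
      using that left_span_carrier[OF assms] by (auto simp: l_minus)
    then show ?thesis using left_span_smult[OF assms _ that] by simp
  qed
  show "left_span K I e \<noteq> {}" using left_span_zero by blast
qed (use assms left_span_carrier left_span_add in auto)

lemma left_independent_finite:
  assumes "finite I" "e \<in> I \<rightarrow> carrier R"
  shows "left_independent K I e \<longleftrightarrow>
    (\<forall>c\<in>I \<rightarrow> K. (\<Oplus>i\<in>I. c i \<otimes> e i) = \<zero> \<longrightarrow> (\<forall>i\<in>I. c i = \<zero>))" (is "_ \<longleftrightarrow> ?R")
proof
  assume R: ?R
  show "left_independent K I e"
    unfolding left_independent_def
  proof (intro allI impI)
    fix J c assume H: "finite J \<and> J \<subseteq> I \<and> c \<in> J \<rightarrow> K \<and> (\<Oplus>i\<in>J. c i \<otimes> e i) = \<zero>"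
    have mem: "c i \<in> carrier R" "e i \<in> carrier R" if "i \<in> J" for i
      using that H assms(2) by (auto dest: Pi_mem)
    let ?d = "\<lambda>i. if i \<in> J then c i else \<zero>"
    have "(\<Oplus>i\<in>J. c i \<otimes> e i) = (\<Oplus>i\<in>I. if i \<in> J then c i \<otimes> e i else \<zero>)"
      by (rule finsum_extend) (use assms(1) H mem in auto)
    also have "\<dots> = (\<Oplus>i\<in>I. ?d i \<otimes> e i)"
      by (rule finsum_cong') (use assms(2) mem in \<open>auto dest: Pi_mem\<close>)
    finally have "(\<Oplus>i\<in>I. ?d i \<otimes> e i) = \<zero>" using H by simp
    moreover have "?d \<in> I \<rightarrow> K" using H by auto
    ultimately have "\<forall>i\<in>I. ?d i = \<zero>" using R[THEN bspec, THEN mp, of ?d] by metis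
    then have "?d i = \<zero>" if "i \<in> J" for i using that H by blast
    then show "\<forall>i\<in>J. c i = \<zero>" by simp
  qed
next
  assume "left_independent K I e"
  then show ?R using assms(1) unfolding left_independent_def by blast
qed

end

end


section \<open>Bases of submodules\<close>

context ring
begin

lemma mult_module_left_module:
  assumes K: "subring K R" and V: "additive_subgroup V R"
    and smult: "\<And>k v. \<lbrakk>k \<in> K; v \<in> V\<rbrakk> \<Longrightarrow> k \<otimes> v \<in> V"
  shows "left_module (R\<lparr>carrier := K\<rparr>) (mult_module R V)"
proof -
  note V' = additive_subgroupE[OF V]
  have V_sub: "v \<in> carrier R" if "v \<in> V" for v using that V'(1) by blast
  have K_sub: "k \<in> carrier R" if "k \<in> K" for k using that subringE(1)[OF K] by blast
  have "abelian_group (mult_module R V)"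
  proof (rule abelian_groupI)
    show "\<exists>w\<in>carrier (mult_module R V). w \<oplus>\<^bsub>mult_module R V\<^esub> v = \<zero>\<^bsub>mult_module R V\<^esub>"
      if "v \<in> carrier (mult_module R V)" for v
      using that by (intro bexI[of _ "\<ominus> v"]) (simp_all add: mult_module_def V'(4) V_sub l_neg)
  qed (simp_all add: mult_module_def V' V_sub a_assoc, simp add: V_sub a_comm)
  moreover have "module_axioms (R\<lparr>carrier := K\<rparr>) (mult_module R V)"
    by unfold_locales
      (simp_all add: mult_module_def smult V_sub K_sub l_distr r_distr m_assoc)
  ultimately show ?thesis
    using subring_is_ring[OF K] by (simp add: left_module_def)
qed

text \<open>\<^const>\<open>finsum\<close> folds within the carrier of its record, so the two sums are different
  terms even though the two records share their addition; they agree because no partial sum leaves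
  \<open>V\<close>.\<close>
lemma finsum_mult_module:
  assumes V: "additive_subgroup V R" and "f \<in> J \<rightarrow> V"
  shows "finsum (mult_module R V) f J = finsum R f J"
proof -
  note V' = additive_subgroupE[OF V]
  have "V \<subseteq> carrier R" by (rule V'(1))
  then have sub: "v \<in> carrier R" if "v \<in> V" for v using that by blast
  have "comm_monoid (add_monoid (mult_module R V))"
    by (rule comm_monoidI) (simp_all add: mult_module_def V'(2,3) sub a_assoc, simp add: sub a_comm)
  then interpret M: abelian_monoid "mult_module R V" by (rule abelian_monoid.intro)
  show ?thesis using assms(2)
  proof (induction J rule: infinite_finite_induct)
    case (insert x F)
    then have "f \<in> F \<rightarrow> V" "f x \<in> V" by auto
    moreover have "V \<subseteq> carrier R" by (rule V'(1))
    ultimately have "f \<in> F \<rightarrow> carrier R" "f x \<in> carrier R"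
       "f \<in> F \<rightarrow> carrier (mult_module R V)" "f x \<in> carrier (mult_module R V)"
      by (auto simp: mult_module_def)
    then show ?case using insert M.finsum_insert[of F x f] by (auto simp: mult_module_def)
  next
    case empty
    show ?case using M.finsum_empty by (simp add: mult_module_def)
  next
    case (infinite J)
    then show ?case using M.finsum_infinite by (simp add: mult_module_def)
  qed
qed

lemma left_span_image:
  assumes K: "subring K R" and e: "e \<in> h ` I \<rightarrow> carrier R"
  shows "left_span K (h ` I) e = left_span K I (\<lambda>i. e (h i))"
proof
  have e': "(\<lambda>i. e (h i)) \<in> I \<rightarrow> carrier R" using e by auto
  note sub = additive_subgroupE[OF left_span_additive_subgroup[OF K e']]
    additive_subgroupE[OF left_span_additive_subgroup[OF K e]]
  show "left_span K (h ` I) e \<subseteq> left_span K I (\<lambda>i. e (h i))"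
    by (rule left_span_minimal) (use sub left_span_generator[OF K e'] in auto)
  show "left_span K I (\<lambda>i. e (h i)) \<subseteq> left_span K (h ` I) e"
    by (rule left_span_minimal) (use sub left_span_generator[OF K e] in auto)
qed

lemma left_independent_reindex:
  assumes K: "subring K R" and h: "inj_on h I" and e: "e \<in> h ` I \<rightarrow> carrier R"
  shows "left_independent K (h ` I) e \<longleftrightarrow> left_independent K I (\<lambda>i. e (h i))"
proof -
  have sum: "(\<Oplus>j\<in>h ` J. c j \<otimes> e j) = (\<Oplus>i\<in>J. c (h i) \<otimes> e (h i))"
    if "J \<subseteq> I" "c \<in> h ` J \<rightarrow> K" for J c
  proof (rule add.finprod_reindex)
    show "(\<lambda>j. c j \<otimes> e j) \<in> h ` J \<rightarrow> carrier R"
      using that e subringE(1)[OF K] by (fastforce simp: Pi_iff)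
    show "inj_on h J" using h that(1) by (rule inj_on_subset)
  qed
  show ?thesis
  proof
    assume L: "left_independent K (h ` I) e"
    show "left_independent K I (\<lambda>i. e (h i))"
      unfolding left_independent_def
    proof (intro allI impI)
      fix J c assume J: "finite J \<and> J \<subseteq> I \<and> c \<in> J \<rightarrow> K \<and> (\<Oplus>i\<in>J. c i \<otimes> e (h i)) = \<zero>"
      let ?d = "\<lambda>j. c (inv_into I h j)"
      have inv: "?d (h i) = c i" if "i \<in> J" for i
        using that J h by (simp add: subset_iff)
      then have d: "?d \<in> h ` J \<rightarrow> K" using J by auto
      have "(\<Oplus>j\<in>h ` J. ?d j \<otimes> e j) = (\<Oplus>i\<in>J. ?d (h i) \<otimes> e (h i))"
        by (rule sum[OF _ d]) (use J in blast)
      also have "\<dots> = (\<Oplus>i\<in>J. c i \<otimes> e (h i))"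
        by (rule finsum_cong') (use J e subringE(1)[OF K] inv in \<open>auto simp: Pi_iff subset_iff\<close>)
      finally have s0: "(\<Oplus>j\<in>h ` J. ?d j \<otimes> e j) = \<zero>" using J by simp
      have "?d j = \<zero>" if "j \<in> h ` J" for j
        using left_independentD[OF L _ _ d s0 that] J by auto
      then have "?d (h i) = \<zero>" if "i \<in> J" for i using that by blast
      then show "\<forall>i\<in>J. c i = \<zero>" using inv by simp
    qed
  next
    assume L: "left_independent K I (\<lambda>i. e (h i))"
    show "left_independent K (h ` I) e"
      unfolding left_independent_def
    proof (intro allI impI)
      fix J' c assume J': "finite J' \<and> J' \<subseteq> h ` I \<and> c \<in> J' \<rightarrow> K \<and> (\<Oplus>j\<in>J'. c j \<otimes> e j) = \<zero>"
      then obtain J where J: "J \<subseteq> I" "J' = h ` J" by (auto simp: subset_image_iff)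
      have "finite J" using J J' h by (metis finite_imageD inj_on_subset)
      moreover have "(\<lambda>i. c (h i)) \<in> J \<rightarrow> K" using J J' by auto
      moreover have "(\<Oplus>i\<in>J. c (h i) \<otimes> e (h i)) = \<zero>" using sum[of J c] J J' by simp
      ultimately have "c (h i) = \<zero>" if "i \<in> J" for i
        using left_independentD[OF L _ J(1)] that by blast
      then show "\<forall>j\<in>J'. c j = \<zero>" using J by blast
    qed
  qed
qed

text \<open>This moves every question about bases of the module \<open>V\<close> into the ring \<open>R\<close>,
  where distributivity of finite sums is available for a coefficient ring \<open>K\<close> that need not be
  commutative.\<close>
lemma basis_family_mult_module_iff:
  assumes K: "subring K R" and V: "additive_subgroup V R"
    and smult: "\<And>k v. \<lbrakk>k \<in> K; v \<in> V\<rbrakk> \<Longrightarrow> k \<otimes> v \<in> V"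
  shows "basis_family (R\<lparr>carrier := K\<rparr>) (mult_module R V) I e \<longleftrightarrow>
    e \<in> I \<rightarrow> V \<and> V = left_span K I e \<and> left_independent K I e"
proof (cases "e \<in> I \<rightarrow> V")
  case True
  have sum: "(\<Oplus>\<^bsub>mult_module R V\<^esub>i\<in>J. c i \<odot>\<^bsub>mult_module R V\<^esub> e i) = (\<Oplus>i\<in>J. c i \<otimes> e i)"
    if "J \<subseteq> I" "c \<in> J \<rightarrow> K" for J c
  proof -
    have "(\<lambda>i. c i \<otimes> e i) \<in> J \<rightarrow> V" using that True smult by (fastforce simp: Pi_iff)
    from finsum_mult_module[OF V this] show ?thesis by (simp add: mult_module_def)
  qed
  have zero: "\<zero>\<^bsub>mult_module R V\<^esub> = \<zero>" and car: "carrier (mult_module R V) = V"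
    by (simp_all add: mult_module_def)
  have "left_span K I e \<subseteq> V"
    by (rule left_span_minimal) (use additive_subgroupE[OF V] smult Pi_mem[OF True] in auto)
  moreover have "V \<subseteq> left_span K I e \<longleftrightarrow>
    (\<forall>v\<in>V. \<exists>J c. finite J \<and> J \<subseteq> I \<and> c \<in> J \<rightarrow> K \<and>
      v = (\<Oplus>\<^bsub>mult_module R V\<^esub>i\<in>J. c i \<odot>\<^bsub>mult_module R V\<^esub> e i))"
    by (simp add: subset_eq left_span_iff sum cong: conj_cong)
  moreover have "left_independent K I e \<longleftrightarrow>
    (\<forall>J c. finite J \<and> J \<subseteq> I \<and> c \<in> J \<rightarrow> K \<and>
      (\<Oplus>\<^bsub>mult_module R V\<^esub>i\<in>J. c i \<odot>\<^bsub>mult_module R V\<^esub> e i) = \<zero> \<longrightarrow> (\<forall>i\<in>J. c i = \<zero>))"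
    unfolding left_independent_def by (simp add: sum cong: conj_cong)
  ultimately show ?thesis
    using True unfolding basis_family_def zero car by auto
next
  case False
  then show ?thesis by (simp add: basis_family_def mult_module_def)
qed

text \<open>A representation of \<open>e i\<close> by the rest of the family is a relation in which
  \<open>e i\<close> has the coefficient \<open>-1\<close>, and \<open>-1\<close> is nonzero in a nonzero
  ring.\<close>
lemma left_independent_insert:
  assumes K: "subring K R" and "\<one> \<noteq> \<zero>" and e: "e \<in> insert i I \<rightarrow> carrier R"
    and ind: "left_independent K (insert i I) e" and "i \<notin> I"
  shows "e i \<notin> left_span K I e"
proof
  assume "e i \<in> left_span K I e"
  then obtain J c where J: "finite J" "J \<subseteq> I" "c \<in> J \<rightarrow> K" "e i = (\<Oplus>j\<in>J. c j \<otimes> e j)"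
    by (rule left_spanE)
  have mem: "c j \<in> carrier R" "e j \<in> carrier R" if "j \<in> J" for j
    using that J e subringE(1)[OF K] by (auto simp: Pi_iff)
  have ei: "e i \<in> carrier R" using e by auto
  let ?d = "\<lambda>j. if j = i then \<ominus> \<one> else c j"
  have "i \<notin> J" using J assms(5) by blast
  then have "(\<Oplus>j\<in>insert i J. ?d j \<otimes> e j) = ?d i \<otimes> e i \<oplus> (\<Oplus>j\<in>J. ?d j \<otimes> e j)"
    using J(1) ei mem by (intro finsum_insert) auto
  also have "(\<Oplus>j\<in>J. ?d j \<otimes> e j) = e i"
    unfolding J(4) by (rule finsum_cong') (use \<open>i \<notin> J\<close> mem in auto)
  also have "?d i \<otimes> e i \<oplus> e i = \<zero>" using ei by (simp add: l_minus l_neg)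
  finally have "(\<Oplus>j\<in>insert i J. ?d j \<otimes> e j) = \<zero>" .
  moreover have "?d \<in> insert i J \<rightarrow> K" using J(3) subringE(3,5)[OF K] by auto
  moreover have "insert i J \<subseteq> insert i I" using J(2) by blast
  ultimately have "?d i = \<zero>"
    using left_independentD[OF ind, of "insert i J" ?d i] J(1) by blast
  then have "\<ominus> \<one> = \<zero>" by simp
  then show False using assms(2) by (metis minus_minus minus_zero one_closed)
qed

lemma left_independent_mono:
  "left_independent K I e \<Longrightarrow> I' \<subseteq> I \<Longrightarrow> left_independent K I' e"
  unfolding left_independent_def by blast

text \<open>Needed to pass from indexed families to \<^const>\<open>is_basis\<close>, which speaks of sets of
  vectors.\<close>
lemma left_independent_inj_on:
  assumes K: "subring K R" and "\<one> \<noteq> \<zero>" and e: "e \<in> I \<rightarrow> carrier R"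
    and ind: "left_independent K I e"
  shows "inj_on e I"
proof (rule inj_onI, rule ccontr)
  fix i j assume ij: "i \<in> I" "j \<in> I" "e i = e j" "i \<noteq> j"
  have ej: "e \<in> {j} \<rightarrow> carrier R" "e j \<in> carrier R" using ij e by auto
  have "e i \<notin> left_span K {j} e"
    by (rule left_independent_insert[OF K assms(2)])
      (use ij e left_independent_mono[OF ind] in auto)
  moreover have "e j \<in> left_span K {j} e"
    by (rule left_span_incl[OF K ej(1)]) simp
  ultimately show False using ij by simp
qed

text \<open>Finitely many generators involve only finitely many members of the family \<open>e\<close> in their
  representations. These members span everything, so by independence there are no others.\<close>
lemma finite_left_independent_generators:
  assumes K: "subring K R" and "\<one> \<noteq> \<zero>" and e: "e \<in> I \<rightarrow> carrier R"
    and ind: "left_independent K I e"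
    and G: "finite G" and g: "g \<in> G \<rightarrow> carrier R"
    and eq: "left_span K G g = left_span K I e"
  shows "finite I"
proof -
  have "\<exists>J. finite J \<and> J \<subseteq> I \<and> g j \<in> left_span K J e" if "j \<in> G" for j
  proof -
    have "g j \<in> left_span K I e" using left_span_incl[OF K g that] eq by simp
    then show ?thesis unfolding left_span_def by blast
  qed
  then obtain J where J: "\<And>j. j \<in> G \<Longrightarrow> finite (J j)" "\<And>j. j \<in> G \<Longrightarrow> J j \<subseteq> I"
    "\<And>j. j \<in> G \<Longrightarrow> g j \<in> left_span K (J j) e" by metis
  let ?U = "\<Union>(J ` G)"
  have U: "finite ?U" "?U \<subseteq> I" using G J by auto
  have eU: "e \<in> ?U \<rightarrow> carrier R" using U e by auto
  note sub = additive_subgroupE[OF left_span_additive_subgroup[OF K eU]]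
  have "left_span K G g \<subseteq> left_span K ?U e"
  proof (rule left_span_minimal)
    fix j k assume "j \<in> G" "k \<in> K"
    moreover have "g j \<in> left_span K ?U e" if "j \<in> G" for j
      using J(3)[OF that] left_span_mono[of "J j" ?U] that by blast
    ultimately show "k \<otimes> g j \<in> left_span K ?U e" using left_span_smult[OF K eU] by blast
  qed (use sub in auto)
  have "I \<subseteq> ?U"
  proof (rule ccontr)
    assume "\<not> I \<subseteq> ?U"
    then obtain i where i: "i \<in> I" "i \<notin> ?U" by blast
    have "e i \<notin> left_span K ?U e"
      by (rule left_independent_insert[OF K assms(2) _ _ i(2)])
        (use i U e left_independent_mono[OF ind] in auto)
    moreover have "e i \<in> left_span K I e" by (rule left_span_incl[OF K e i(1)])
    ultimately show False
      using \<open>left_span K G g \<subseteq> left_span K ?U e\<close> eq by blast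
  qed
  with U(1) show ?thesis by (rule rev_finite_subset)
qed

lemma left_span_is_basis_iff:
  assumes K: "subring K R" and e: "e \<in> I \<rightarrow> carrier R"
  shows "is_basis (R\<lparr>carrier := K\<rparr>) (mult_module R (left_span K I e)) S \<longleftrightarrow>
    S \<subseteq> carrier R \<and> left_span K S (\<lambda>v. v) = left_span K I e \<and> left_independent K S (\<lambda>v. v)"
proof -
  have "S \<subseteq> left_span K S (\<lambda>v. v)" if "S \<subseteq> carrier R"
    using left_span_incl[OF K, of "\<lambda>v. v" S] that by auto
  then show ?thesis
    unfolding is_basis_def
    by (subst basis_family_mult_module_iff[OF K left_span_additive_subgroup[OF K e]])
      (use left_span_smult[OF K e] left_span_carrier[OF K e] in auto)
qed

text \<open>Once one finite basis is known all bases are finite, so a dimension is well defined as soon as all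
  finite bases have the same size. Each kind of coefficient ring has its own reason for the latter.\<close>
lemma free_of_dim_left_span:
  assumes K: "subring K R" and "\<one> \<noteq> \<zero>" and "finite I" and e: "e \<in> I \<rightarrow> carrier R"
    and ind: "left_independent K I e"
    and card: "\<And>S. \<lbrakk>finite S; S \<subseteq> carrier R; left_span K S (\<lambda>v. v) = left_span K I e;
      left_independent K S (\<lambda>v. v)\<rbrakk> \<Longrightarrow> card S = d"
  shows "free_of_dim (R\<lparr>carrier := K\<rparr>) (mult_module R (left_span K I e)) d"
proof -
  note iff = left_span_is_basis_iff[OF K e]
  have "left_module (R\<lparr>carrier := K\<rparr>) (mult_module R (left_span K I e))"
    by (rule mult_module_left_module[OF K left_span_additive_subgroup[OF K e]])
      (rule left_span_smult[OF K e])
  moreover have "is_basis (R\<lparr>carrier := K\<rparr>) (mult_module R (left_span K I e)) (e ` I)"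
    unfolding iff
    using left_span_image[OF K, of "\<lambda>v. v" e I] left_independent_reindex[OF K, of e I "\<lambda>v. v"]
      left_independent_inj_on[OF K assms(2) e ind] ind e by auto
  moreover have "finite S \<and> card S = d"
    if "is_basis (R\<lparr>carrier := K\<rparr>) (mult_module R (left_span K I e)) S" for S
  proof -
    have S: "S \<subseteq> carrier R" "left_span K S (\<lambda>v. v) = left_span K I e"
      "left_independent K S (\<lambda>v. v)" using that unfolding iff by auto
    have "finite S"
      by (rule finite_left_independent_generators[OF K assms(2) _ S(3) \<open>finite I\<close> e])
        (use S in auto)
    then show ?thesis using card S by blast
  qed
  ultimately show ?thesis unfolding free_of_dim_def by blast
qed

end


section \<open>Well-defined dimensions\<close>

context ring
begin

text \<open>The coordinate isomorphism of a basis.\<close>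
lemma free_module_coordinates:
  assumes K: "subring K R" and e: "e \<in> {..<m} \<rightarrow> carrier R"
    and ind: "left_independent K {..<m} e"
  shows "(\<lambda>v. \<Oplus>i\<in>{..<m}. v i \<otimes> e i) \<in>
    left_module_iso (R\<lparr>carrier := K\<rparr>) (free_module (R\<lparr>carrier := K\<rparr>) m)
      (mult_module R (left_span K {..<m} e))"
proof -
  let ?\<phi> = "\<lambda>v. \<Oplus>i\<in>{..<m}. v i \<otimes> e i"
  let ?M = "free_module (R\<lparr>carrier := K\<rparr>) m"
  have M: "carrier ?M = {..<m} \<rightarrow>\<^sub>E K"
    "v \<oplus>\<^bsub>?M\<^esub> w = (\<lambda>i\<in>{..<m}. v i \<oplus> w i)" "k \<odot>\<^bsub>?M\<^esub> v = (\<lambda>i\<in>{..<m}. k \<otimes> v i)"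
    for v w k by (simp_all add: free_module_def)
  have K_sub: "k \<in> carrier R" if "k \<in> K" for k using that subringE(1)[OF K] by blast
  have mem: "v i \<in> carrier R" if "v \<in> {..<m} \<rightarrow>\<^sub>E K" "i < m" for v i
    by (rule K_sub) (use PiE_mem[OF that(1)] that(2) in auto)
  have e_mem: "e i \<in> carrier R" if "i < m" for i using Pi_mem[OF e] that by simp
  have "inj_on ?\<phi> ({..<m} \<rightarrow>\<^sub>E K)"
  proof (rule inj_onI)
    fix v w assume v: "v \<in> {..<m} \<rightarrow>\<^sub>E K" and w: "w \<in> {..<m} \<rightarrow>\<^sub>E K" and eq: "?\<phi> v = ?\<phi> w"
    have "(\<Oplus>i\<in>{..<m}. (v i \<ominus> w i) \<otimes> e i) = (\<Oplus>i\<in>{..<m}. v i \<otimes> e i \<ominus> w i \<otimes> e i)"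
      by (rule finsum_cong') (use mem[OF v] mem[OF w] e_mem in \<open>auto simp: a_minus_def l_distr l_minus\<close>)
    also have "\<dots> = ?\<phi> v \<ominus> ?\<phi> w"
      by (rule finsum_minus) (use mem[OF v] mem[OF w] e_mem in auto)
    also have "\<dots> = \<zero>"
      unfolding eq by (rule r_right_minus_eq[THEN iffD2]) (use mem[OF w] e_mem in \<open>auto intro!: finsum_closed\<close>)
    finally have s0: "(\<Oplus>i\<in>{..<m}. (v i \<ominus> w i) \<otimes> e i) = \<zero>" .
    have cK: "(\<lambda>i. v i \<ominus> w i) \<in> {..<m} \<rightarrow> K"
      using v w subringE(5,7)[OF K] by (auto simp: a_minus_def PiE_iff)
    have "v i = w i" if "i \<in> {..<m}" for i
      using left_independentD[OF ind finite_lessThan subset_refl cK s0 that]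
        mem[OF v] mem[OF w] that by simp
    then show "v = w" by (rule PiE_ext[OF v w])
  qed
  moreover have "?\<phi> ` ({..<m} \<rightarrow>\<^sub>E K) = left_span K {..<m} e"
  proof
    show "?\<phi> ` ({..<m} \<rightarrow>\<^sub>E K) \<subseteq> left_span K {..<m} e"
      unfolding left_span_finite[OF K finite_lessThan e] by (auto simp: PiE_def)
    show "left_span K {..<m} e \<subseteq> ?\<phi> ` ({..<m} \<rightarrow>\<^sub>E K)"
    proof
      fix x assume "x \<in> left_span K {..<m} e"
      then obtain c where c: "c \<in> {..<m} \<rightarrow> K" "x = (\<Oplus>i\<in>{..<m}. c i \<otimes> e i)"
        unfolding left_span_finite[OF K finite_lessThan e] by blast
      have "x = ?\<phi> (restrict c {..<m})"
        unfolding c(2) by (rule finsum_cong') (use K_sub Pi_mem[OF c(1)] e_mem in auto)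
      moreover have "restrict c {..<m} \<in> {..<m} \<rightarrow>\<^sub>E K" using c(1) by simp
      ultimately show "x \<in> ?\<phi> ` ({..<m} \<rightarrow>\<^sub>E K)" by (rule image_eqI)
    qed
  qed
  moreover have "?\<phi> (\<lambda>i\<in>{..<m}. v i \<oplus> w i) = ?\<phi> v \<oplus> ?\<phi> w"
    if "v \<in> {..<m} \<rightarrow>\<^sub>E K" "w \<in> {..<m} \<rightarrow>\<^sub>E K" for v w
  proof -
    note mem' = mem[OF that(1)] mem[OF that(2)] e_mem
    have "?\<phi> (\<lambda>i\<in>{..<m}. v i \<oplus> w i) = (\<Oplus>i\<in>{..<m}. v i \<otimes> e i \<oplus> w i \<otimes> e i)"
      by (rule finsum_cong') (use mem' in \<open>auto simp: l_distr\<close>)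
    also have "\<dots> = ?\<phi> v \<oplus> ?\<phi> w" by (rule finsum_addf) (use mem' in auto)
    finally show ?thesis .
  qed
  moreover have "?\<phi> (\<lambda>i\<in>{..<m}. k \<otimes> v i) = k \<otimes> ?\<phi> v"
    if "k \<in> K" "v \<in> {..<m} \<rightarrow>\<^sub>E K" for v k
  proof -
    note mem' = mem[OF that(2)] e_mem K_sub[OF that(1)]
    have "k \<otimes> ?\<phi> v = (\<Oplus>i\<in>{..<m}. k \<otimes> (v i \<otimes> e i))"
      by (rule finsum_rdistr) (use mem' in auto)
    also have "\<dots> = ?\<phi> (\<lambda>i\<in>{..<m}. k \<otimes> v i)"
      by (rule finsum_cong') (use mem' in \<open>auto simp: m_assoc\<close>)
    finally show ?thesis by simp
  qed
  ultimately show ?thesis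
    by (simp add: left_module_iso_def M bij_betw_def mult_module_def)
qed

text \<open>The isomorphism is \<open>f\<close> followed by the inverse of \<open>g\<close>. That this inverse
  is linear is checked by applying \<open>g\<close> to sums and multiples formed in \<open>N\<close>, which
  therefore have to stay in the carrier of \<open>N\<close>.\<close>
lemma left_module_iso_common_target:
  assumes f: "f \<in> left_module_iso K M P" and g: "g \<in> left_module_iso K N P"
    and add: "\<And>v w. \<lbrakk>v \<in> carrier N; w \<in> carrier N\<rbrakk> \<Longrightarrow> v \<oplus>\<^bsub>N\<^esub> w \<in> carrier N"
    and smult: "\<And>k v. \<lbrakk>k \<in> carrier K; v \<in> carrier N\<rbrakk> \<Longrightarrow> k \<odot>\<^bsub>N\<^esub> v \<in> carrier N"
  shows "(\<lambda>v. inv_into (carrier N) g (f v)) \<in> left_module_iso K M N"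
proof -
  let ?h = "inv_into (carrier N) g"
  have bf: "bij_betw f (carrier M) (carrier P)" and bg: "bij_betw g (carrier N) (carrier P)"
    using f g by (auto simp: left_module_iso_def)
  have bh: "bij_betw ?h (carrier P) (carrier N)" by (rule bij_betw_inv_into[OF bg])
  have gh: "g (?h y) = y" "?h y \<in> carrier N" if "y \<in> carrier P" for y
    using bij_betw_inv_into_right[OF bg that] bij_betwE[OF bh] that by auto
  have hg: "?h (g x) = x" if "x \<in> carrier N" for x
    using bij_betw_inv_into_left[OF bg that] .
  have fP: "f v \<in> carrier P" if "v \<in> carrier M" for v using bij_betwE[OF bf] that by blast
  have "?h (y \<oplus>\<^bsub>P\<^esub> z) = ?h y \<oplus>\<^bsub>N\<^esub> ?h z" if "y \<in> carrier P" "z \<in> carrier P" for y z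
  proof -
    have "g (?h y \<oplus>\<^bsub>N\<^esub> ?h z) = y \<oplus>\<^bsub>P\<^esub> z"
      using g gh that by (simp add: left_module_iso_def)
    then show ?thesis using hg[of "?h y \<oplus>\<^bsub>N\<^esub> ?h z"] add gh that by simp
  qed
  moreover have "?h (k \<odot>\<^bsub>P\<^esub> y) = k \<odot>\<^bsub>N\<^esub> ?h y" if "k \<in> carrier K" "y \<in> carrier P" for k y
  proof -
    have "g (k \<odot>\<^bsub>N\<^esub> ?h y) = k \<odot>\<^bsub>P\<^esub> y"
      using g gh that by (simp add: left_module_iso_def)
    then show ?thesis using hg[of "k \<odot>\<^bsub>N\<^esub> ?h y"] smult gh that by simp
  qed
  ultimately show ?thesis
    using f fP bij_betw_trans[OF bf bh] by (simp add: left_module_iso_def comp_def)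
qed

lemma invariant_basis_number_lessThan:
  fixes m n :: nat
  assumes K: "subring K R" and ibn: "invariant_basis_number (R\<lparr>carrier := K\<rparr>)"
    and "e \<in> {..<m} \<rightarrow> carrier R" "left_independent K {..<m} e"
    and "e' \<in> {..<n} \<rightarrow> carrier R" "left_independent K {..<n} e'"
    and eq: "left_span K {..<m} e = left_span K {..<n} e'"
  shows "m = n"
proof -
  let ?N = "free_module (R\<lparr>carrier := K\<rparr>) n"
  note f = free_module_coordinates[OF K assms(3,4)]
  note g = free_module_coordinates[OF K assms(5,6), folded eq]
  have "v \<oplus>\<^bsub>?N\<^esub> w \<in> carrier ?N" if "v \<in> carrier ?N" "w \<in> carrier ?N" for v w
    using that subringE(7)[OF K] by (auto simp: free_module_def PiE_iff)
  moreover have "k \<odot>\<^bsub>?N\<^esub> v \<in> carrier ?N" if "k \<in> carrier (R\<lparr>carrier := K\<rparr>)" "v \<in> carrier ?N" for k v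
    using that subringE(6)[OF K] by (auto simp: free_module_def PiE_iff)
  ultimately have "left_module_iso (R\<lparr>carrier := K\<rparr>) (free_module (R\<lparr>carrier := K\<rparr>) m) ?N \<noteq> {}"
    using left_module_iso_common_target[OF f g] by blast
  then show ?thesis using ibn unfolding invariant_basis_number_def by blast
qed

text \<open>Two bases of the same module give two coordinate isomorphisms onto it, hence an isomorphism between
  the free modules of their sizes.\<close>
lemma invariant_basis_number_card_eq:
  assumes K: "subring K R" and ibn: "invariant_basis_number (R\<lparr>carrier := K\<rparr>)"
    and I: "finite I" and e: "e \<in> I \<rightarrow> carrier R" and ie: "left_independent K I e"
    and J: "finite J" and f: "f \<in> J \<rightarrow> carrier R" and jf: "left_independent K J f"
    and eq: "left_span K I e = left_span K J f"
  shows "card I = card J"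
proof -
  obtain h where h: "bij_betw h {..<card I} I"
    using ex_bij_betw_nat_finite[OF I] by (auto simp: lessThan_atLeast0)
  obtain h' where h': "bij_betw h' {..<card J} J"
    using ex_bij_betw_nat_finite[OF J] by (auto simp: lessThan_atLeast0)
  have im: "h ` {..<card I} = I" "h' ` {..<card J} = J"
    and inj: "inj_on h {..<card I}" "inj_on h' {..<card J}"
    using h h' by (auto simp: bij_betw_def)
  show ?thesis
  proof (rule invariant_basis_number_lessThan[OF K ibn])
    show "(\<lambda>i. e (h i)) \<in> {..<card I} \<rightarrow> carrier R" "(\<lambda>i. f (h' i)) \<in> {..<card J} \<rightarrow> carrier R"
      using e f h h' by (auto simp: bij_betw_def)
    show "left_independent K {..<card I} (\<lambda>i. e (h i))"
      using left_independent_reindex[OF K inj(1), of e] im e ie by simp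
    show "left_independent K {..<card J} (\<lambda>i. f (h' i))"
      using left_independent_reindex[OF K inj(2), of f] im f jf by simp
    show "left_span K {..<card I} (\<lambda>i. e (h i)) = left_span K {..<card J} (\<lambda>i. f (h' i))"
      using left_span_image[OF K, of e h "{..<card I}"] left_span_image[OF K, of f h' "{..<card J}"]
        im e f eq by simp
  qed
qed

text \<open>Over the zero ring all coefficients vanish, so the families with no and with one vector are both
  bases of the zero module.\<close>
lemma invariant_basis_number_nontrivial:
  assumes K: "subring K R" and ibn: "invariant_basis_number (R\<lparr>carrier := K\<rparr>)"
  shows "\<one> \<noteq> \<zero>"
proof
  assume "\<one> = \<zero>"
  then have triv: "carrier R = {\<zero>}" using carrier_one_zero by blast
  have K0: "k = \<zero>" if "k \<in> K" for k using that subringE(1)[OF K] triv by blast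
  have "left_independent K I e" for I :: "nat set" and e
    unfolding left_independent_def using K0 by blast
  moreover have "left_span K I e = {\<zero>}" if "e \<in> I \<rightarrow> carrier R" for I :: "nat set" and e
    using left_span_carrier[OF K that] left_span_zero[of K I e] triv by blast
  moreover have "(\<lambda>_. \<zero>) \<in> {..<m} \<rightarrow> carrier R" for m :: nat by auto
  ultimately have "0 = (1::nat)"
    using invariant_basis_number_lessThan[OF K ibn, of "\<lambda>_. \<zero>" 0 "\<lambda>_. \<zero>" 1] by metis
  then show False by simp
qed

lemma free_of_dim_invariant_basis_number:
  assumes K: "subring K R" and ibn: "invariant_basis_number (R\<lparr>carrier := K\<rparr>)"
    and I: "finite I" and e: "e \<in> I \<rightarrow> carrier R" and ind: "left_independent K I e"
  shows "free_of_dim (R\<lparr>carrier := K\<rparr>) (mult_module R (left_span K I e)) (card I)"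
proof (rule free_of_dim_left_span[OF K invariant_basis_number_nontrivial[OF K ibn] I e ind])
  fix S assume "finite S" "S \<subseteq> carrier R" "left_span K S (\<lambda>v. v) = left_span K I e"
    "left_independent K S (\<lambda>v. v)"
  then show "card S = card I"
    by (intro invariant_basis_number_card_eq[OF K ibn _ _ _ I e ind]) auto
qed

text \<open>Links left spans to the linear algebra over a subfield of a ring, from which the invariance of
  dimension over a field is taken.\<close>
lemma Span_eq_left_span:
  assumes K: "subfield K R" and Us: "set Us \<subseteq> carrier R"
  shows "Span K Us = left_span K (set Us) (\<lambda>v. v)"
proof
  note K' = subfieldE(1)[OF K]
  have id: "(\<lambda>v. v) \<in> set Us \<rightarrow> carrier R" using Us by auto
  show "Span K Us \<subseteq> left_span K (set Us) (\<lambda>v. v)"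
  proof (rule Span_min[OF K Us])
    show "subgroup (left_span K (set Us) (\<lambda>v. v)) (add_monoid R)"
      using left_span_additive_subgroup[OF K' id] by (rule additive_subgroup.a_subgroup)
    show "K <#> set Us \<subseteq> left_span K (set Us) (\<lambda>v. v)"
      using left_span_generator[OF K' id] by (auto simp: set_mult_def)
  qed
  have "additive_subgroup (Span K Us) R"
    using Span_is_add_subgroup[OF K Us] by (rule additive_subgroupI)
  note sub = additive_subgroupE[OF this]
  show "left_span K (set Us) (\<lambda>v. v) \<subseteq> Span K Us"
    by (rule left_span_minimal) (use sub Span_base_incl[OF K Us] Span_smult_closed[OF K Us] in auto)
qed

lemma combine_map:
  assumes "distinct Us" "set Us \<subseteq> carrier R" "c \<in> set Us \<rightarrow> carrier R"
  shows "combine (map c Us) Us = (\<Oplus>u\<in>set Us. c u \<otimes> u)"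
  using assms
proof (induction Us)
  case (Cons u Us)
  then have "(\<lambda>u. c u \<otimes> u) \<in> set Us \<rightarrow> carrier R" by auto
  then show ?case using Cons by simp
qed simp

text \<open>The list must be distinct because a coefficient function on its set of entries cannot give two
  coefficients to a repeated vector.\<close>
lemma independent_iff_left_independent:
  assumes K: "subfield K R" and Us: "distinct Us" "set Us \<subseteq> carrier R"
  shows "independent K Us \<longleftrightarrow> left_independent K (set Us) (\<lambda>v. v)"
proof
  note K' = subfieldE(1)[OF K]
  have id: "(\<lambda>v. v) \<in> set Us \<rightarrow> carrier R" using Us by auto
  assume ind: "independent K Us"
  show "left_independent K (set Us) (\<lambda>v. v)"
    unfolding left_independent_finite[OF K' finite_set id]
  proof (intro ballI impI)
    fix c u assume c: "c \<in> set Us \<rightarrow> K" and s0: "(\<Oplus>u\<in>set Us. c u \<otimes> u) = \<zero>" and u: "u \<in> set Us"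
    have "c \<in> set Us \<rightarrow> carrier R" using c subringE(1)[OF K'] by auto
    from combine_map[OF Us this] s0 have "combine (map c Us) Us = \<zero>" by simp
    moreover have "set (map c Us) \<subseteq> K" using c by auto
    ultimately have "set (take (length Us) (map c Us)) \<subseteq> {\<zero>}"
      using independent_imp_trivial_combine[OF K ind] by blast
    then show "c u = \<zero>" using u by auto
  qed
next
  note K' = subfieldE(1)[OF K]
  have one: "\<one> \<noteq> \<zero>" using subfieldE(6)[OF K] by simp
  assume "left_independent K (set Us) (\<lambda>v. v)"
  then show "independent K Us"
    using Us
  proof (induction Us)
    case (Cons u Us)
    then have "u \<notin> left_span K (set Us) (\<lambda>v. v)"
      using left_independent_insert[OF K' one, of "\<lambda>v. v" u "set Us"] by auto
    moreover have "left_independent K (set Us) (\<lambda>v. v)"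
      by (rule left_independent_mono[OF Cons.prems(1)]) auto
    ultimately show ?case
      using Cons Span_eq_left_span[OF K, of Us] by (intro li_Cons) (auto simp del: Span.simps)
  qed simp
qed

lemma free_of_dim_subfield:
  assumes K: "subfield K R" and I: "finite I" and e: "e \<in> I \<rightarrow> carrier R"
  shows "\<exists>d. free_of_dim (R\<lparr>carrier := K\<rparr>) (mult_module R (left_span K I e)) d"
proof -
  note K' = subfieldE(1)[OF K]
  have one: "\<one> \<noteq> \<zero>" using subfieldE(6)[OF K] by simp
  obtain Us where Us: "set Us = e ` I" using finite_list[of "e ` I"] I by blast
  have Us_sub: "set Us \<subseteq> carrier R" using Us e by auto
  have "Span K Us = left_span K I e"
    unfolding Span_eq_left_span[OF K Us_sub] Us
    by (rule left_span_image[OF K']) (use Us Us_sub in auto)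
  then obtain d where d: "dimension d K (left_span K I e)"
    using Span_finite_dimension[OF K Us_sub] by auto
  obtain Vs where Vs: "set Vs \<subseteq> carrier R" "independent K Vs" "Span K Vs = left_span K I e"
    using exists_base[OF K d] by blast
  have dist: "distinct Vs" using independent_distinct[OF K Vs(2)] .
  have id: "(\<lambda>v. v) \<in> set Vs \<rightarrow> carrier R" using Vs(1) by auto
  have ind: "left_independent K (set Vs) (\<lambda>v. v)"
    using independent_iff_left_independent[OF K dist Vs(1)] Vs(2) by simp
  have span: "left_span K (set Vs) (\<lambda>v. v) = left_span K I e"
    using Span_eq_left_span[OF K Vs(1)] Vs(3) by (simp del: Span.simps)
  have "free_of_dim (R\<lparr>carrier := K\<rparr>) (mult_module R (left_span K (set Vs) (\<lambda>v. v))) d"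
  proof (rule free_of_dim_left_span[OF K' one finite_set id ind])
    fix S assume S: "finite S" "S \<subseteq> carrier R"
      "left_span K S (\<lambda>v. v) = left_span K (set Vs) (\<lambda>v. v)" "left_independent K S (\<lambda>v. v)"
    obtain Ws where Ws: "set Ws = S" "distinct Ws" using finite_distinct_list[OF S(1)] by blast
    have "independent K Ws"
      using independent_iff_left_independent[OF K Ws(2)] Ws S by simp
    then have "dimension (length Ws) K (left_span K I e)"
      using dimension_independent[of K Ws] Span_eq_left_span[OF K, of Ws] Ws S span by (simp del: Span.simps)
    then have "length Ws = d" using dimension_is_inj[OF K _ d] by blast
    then show "card S = d" using Ws distinct_card by blast
  qed
  then show ?thesis using span by auto
qed

end


section \<open>Internal direct sums\<close>

context ring
begin

lemma internal_direct_sum_subgroup: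
  "internal_direct_sum R B \<Longrightarrow> additive_subgroup (B n) R"
  by (simp add: internal_direct_sum_def)

lemma internal_direct_sum_decompose:
  assumes "internal_direct_sum R B" "a \<in> carrier R"
  obtains f N where "\<And>n. f n \<in> B n" "finite N" "\<And>n. n \<notin> N \<Longrightarrow> f n = \<zero>" "a = (\<Oplus>n\<in>N. f n)"
proof -
  obtain f where f: "\<forall>n. f n \<in> B n" "finite {n. f n \<noteq> \<zero>}" "a = (\<Oplus>n\<in>{n. f n \<noteq> \<zero>}. f n)"
    using assms unfolding internal_direct_sum_def by blast
  show ?thesis
    by (rule that[of f "{n. f n \<noteq> \<zero>}"]) (use f in simp_all)
qed

text \<open>The definition of a direct sum takes sums over exact supports. Allowing any finite set that contains
  the support makes it possible to compare decompositions whose supports are not known.\<close>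
lemma internal_direct_sum_unique:
  assumes B: "internal_direct_sum R B"
    and f: "\<And>n. f n \<in> B n" "finite N" "\<And>n. n \<notin> N \<Longrightarrow> f n = \<zero>"
    and g: "\<And>n. g n \<in> B n" "finite M" "\<And>n. n \<notin> M \<Longrightarrow> g n = \<zero>"
    and eq: "(\<Oplus>n\<in>N. f n) = (\<Oplus>n\<in>M. g n)"
  shows "f = g"
proof -
  let ?P = "\<lambda>a h. (\<forall>n. h n \<in> B n) \<and> finite {n. h n \<noteq> \<zero>} \<and> a = (\<Oplus>n\<in>{n. h n \<noteq> \<zero>}. h n)"
  have B_sub: "B n \<subseteq> carrier R" for n
    using additive_subgroupE(1)[OF internal_direct_sum_subgroup[OF B]] .
  have supp: "?P (\<Oplus>n\<in>N. h n) h"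
    if "\<And>n. h n \<in> B n" "finite N" "\<And>n. n \<notin> N \<Longrightarrow> h n = \<zero>" for h N
  proof (intro conjI allI)
    have sub: "{n. h n \<noteq> \<zero>} \<subseteq> N" using that(3) by blast
    then show "finite {n. h n \<noteq> \<zero>}" using that(2) by (rule finite_subset)
    have "h n \<in> carrier R" for n using that(1) B_sub by blast
    then show "(\<Oplus>n\<in>N. h n) = (\<Oplus>n\<in>{n. h n \<noteq> \<zero>}. h n)"
      by (intro add.finprod_mono_neutral_cong_right[OF that(2) sub]) auto
  qed (rule that(1))
  have "f n \<in> carrier R" for n using f(1) B_sub by blast
  then have "(\<Oplus>n\<in>N. f n) \<in> carrier R" by (intro finsum_closed) auto
  then have "\<exists>!h. ?P (\<Oplus>n\<in>N. f n) h"
    using B unfolding internal_direct_sum_def by blast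
  moreover have "?P (\<Oplus>n\<in>N. f n) f" by (rule supp[OF f])
  moreover have "?P (\<Oplus>n\<in>N. f n) g" unfolding eq by (rule supp[OF g])
  ultimately show ?thesis by blast
qed

text \<open>Two decompositions of an element differ by a decomposition of zero, so uniqueness is only required
  there.\<close>
lemma internal_direct_sumI:
  assumes sub: "\<And>n. additive_subgroup (B n) R"
    and ex: "\<And>a. a \<in> carrier R \<Longrightarrow> \<exists>N f. finite N \<and> (\<forall>n. f n \<in> B n) \<and> a = (\<Oplus>n\<in>N. f n)"
    and ind: "\<And>N f n. \<lbrakk>finite N; \<And>n. f n \<in> B n; (\<Oplus>n\<in>N. f n) = \<zero>; n \<in> N\<rbrakk> \<Longrightarrow> f n = \<zero>"
  shows "internal_direct_sum R B"
  unfolding internal_direct_sum_def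
proof (intro conjI allI ballI)
  note B = additive_subgroupE[OF sub]
  have car: "b \<in> carrier R" if "b \<in> B n" for b n using B(1) that by blast
  fix a assume "a \<in> carrier R"
  then obtain N f where N: "finite N" "\<And>n. f n \<in> B n" "a = (\<Oplus>n\<in>N. f n)" using ex by blast
  let ?P = "\<lambda>h. (\<forall>n. h n \<in> B n) \<and> finite {n. h n \<noteq> \<zero>} \<and> a = (\<Oplus>n\<in>{n. h n \<noteq> \<zero>}. h n)"
  let ?h = "\<lambda>n. if n \<in> N then f n else \<zero>"
  have mem: "f n \<in> carrier R" for n using car N(2) .
  show "\<exists>!h. ?P h"
  proof (rule ex1I[of _ ?h])
    have supp: "{n. ?h n \<noteq> \<zero>} \<subseteq> N" by auto
    have "a = (\<Oplus>n\<in>{n. ?h n \<noteq> \<zero>}. ?h n)"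
      unfolding N(3) by (rule add.finprod_mono_neutral_cong_right[OF N(1) supp]) (use mem in auto)
    then show "?P ?h" using N(2) B(2) finite_subset[OF supp N(1)] by auto
  next
    fix g assume g: "?P g"
    then have g_mem: "g n \<in> carrier R" for n using car by blast
    let ?M = "N \<union> {n. g n \<noteq> \<zero>}"
    have M: "finite ?M" using N(1) g by blast
    have "(\<Oplus>n\<in>?M. ?h n \<ominus> g n) = (\<Oplus>n\<in>?M. ?h n) \<ominus> (\<Oplus>n\<in>?M. g n)"
      by (rule finsum_minus) (use mem g_mem in auto)
    also have "(\<Oplus>n\<in>?M. ?h n) = a"
      unfolding N(3) by (rule add.finprod_mono_neutral_cong_right[OF M]) (use mem in auto)
    also have "(\<Oplus>n\<in>?M. g n) = (\<Oplus>n\<in>{n. g n \<noteq> \<zero>}. g n)"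
      by (rule add.finprod_mono_neutral_cong_right[OF M]) (use g_mem in auto)
    also have "\<dots> = a" using g by simp
    also have "a \<ominus> a = \<zero>" using \<open>a \<in> carrier R\<close> by simp
    finally have "(\<Oplus>n\<in>?M. ?h n \<ominus> g n) = \<zero>" .
    moreover have "?h n \<ominus> g n \<in> B n" for n
      using N(2) g B(2-4) by (auto simp: a_minus_def)
    ultimately have diff: "?h n \<ominus> g n = \<zero>" if "n \<in> ?M" for n
      using ind[OF M, of "\<lambda>n. ?h n \<ominus> g n"] that by blast
    show "g = ?h"
    proof
      fix n
      have h_mem: "?h n \<in> carrier R" using mem by simp
      show "g n = ?h n"
      proof (cases "n \<in> ?M")
        case True
        then have "?h n = g n" using diff[OF True] r_right_minus_eq[OF h_mem g_mem] by blast
        then show ?thesis by (rule sym)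
      qed auto
    qed
  qed
qed (rule sub)

text \<open>Collecting the terms \<open>t j\<close> by weight yields a decomposition of the sum into
  components. A sum that lies in \<open>B n\<close> is also its own decomposition, and decompositions are
  unique.\<close>
lemma homogeneous_part:
  assumes B: "internal_direct_sum R B" and J: "finite J"
    and t: "\<And>j. j \<in> J \<Longrightarrow> t j \<in> B (wt j)" and a: "(\<Oplus>j\<in>J. t j) \<in> B n"
  shows "(\<Oplus>j\<in>J. t j) = (\<Oplus>j\<in>{j \<in> J. wt j = n}. t j)"
proof -
  note sub = additive_subgroupE[OF internal_direct_sum_subgroup[OF B]]
  let ?f = "\<lambda>k. \<Oplus>j\<in>{j \<in> J. wt j = k}. t j"
  let ?g = "\<lambda>k. if k = n then (\<Oplus>j\<in>J. t j) else \<zero>"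
  have "t j \<in> carrier R" if "j \<in> J" for j using t[OF that] sub(1) by blast
  then have t_mem: "t \<in> J \<rightarrow> carrier R" by blast
  have a_mem: "(\<Oplus>j\<in>J. t j) \<in> carrier R" using t_mem by (rule finsum_closed)
  have "?f = ?g"
  proof (rule internal_direct_sum_unique[OF B])
    show "?f k \<in> B k" for k
      by (rule finsum_mem) (use sub t in auto)
    show "?g k \<in> B k" for k using a sub(2) by simp
    show "finite (wt ` J)" "finite {n}" using J by auto
    show "?f k = \<zero>" if "k \<notin> wt ` J" for k
    proof -
      have "{j \<in> J. wt j = k} = {}" using that by auto
      then show ?thesis by (simp only: finsum_empty)
    qed
    show "?g k = \<zero>" if "k \<notin> {n}" for k using that by simp
    show "(\<Oplus>k\<in>wt ` J. ?f k) = (\<Oplus>k\<in>{n}. ?g k)"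
      using finsum_fibres[OF J t_mem, of wt] a_mem by simp
  qed
  from fun_cong[OF this, of n] show ?thesis by simp
qed

text \<open>Any partition of a basis of \<open>R\<close>, here by the values of a weight function, splits
  \<open>R\<close> into the spans of its classes: a relation between elements of distinct classes is a relation
  between basis vectors.\<close>
lemma left_span_grading:
  assumes K: "subring K R" and e: "e \<in> I \<rightarrow> carrier R"
    and span: "left_span K I e = carrier R" and ind: "left_independent K I e"
  shows "internal_direct_sum R (\<lambda>n. left_span K {i \<in> I. wt i = n} e)" (is "internal_direct_sum R ?B")
proof (rule internal_direct_sumI)
  have e': "e \<in> {i \<in> I. wt i = n} \<rightarrow> carrier R" for n using e by auto
  show sub: "additive_subgroup (?B n) R" for n
    by (rule left_span_additive_subgroup[OF K e'])
  have mem: "c i \<otimes> e i \<in> carrier R" if "c \<in> J \<rightarrow> K" "J \<subseteq> I" "i \<in> J" for c J i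
    using subsetD[OF subringE(1)[OF K] Pi_mem[OF that(1,3)]] Pi_mem[OF e subsetD[OF that(2,3)]] by simp
  show "\<exists>N f. finite N \<and> (\<forall>n. f n \<in> ?B n) \<and> a = (\<Oplus>n\<in>N. f n)" if "a \<in> carrier R" for a
  proof -
    obtain J c where J: "finite J" "J \<subseteq> I" "c \<in> J \<rightarrow> K" and a: "a = (\<Oplus>i\<in>J. c i \<otimes> e i)"
      using left_spanE[of a K I e] \<open>a \<in> carrier R\<close> unfolding span .
    let ?f = "\<lambda>n. \<Oplus>i\<in>{i \<in> J. wt i = n}. c i \<otimes> e i"
    show ?thesis
    proof (intro exI conjI allI)
      show "finite (wt ` J)" using J(1) by simp
      show "?f n \<in> ?B n" for n by (rule left_span_mem) (use J in auto)
      show "a = (\<Oplus>n\<in>wt ` J. ?f n)"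
        unfolding a by (rule finsum_fibres[OF J(1)]) (use mem[OF J(3,2)] in auto)
    qed
  qed
  fix N f n assume N: "finite N" and f: "\<And>n. f n \<in> ?B n" and s0: "(\<Oplus>n\<in>N. f n) = \<zero>" and n: "n \<in> N"
  have "\<forall>n. \<exists>J c. finite J \<and> J \<subseteq> {i \<in> I. wt i = n} \<and> c \<in> J \<rightarrow> K \<and> f n = (\<Oplus>i\<in>J. c i \<otimes> e i)"
    by (rule allI) (rule f[unfolded left_span_iff])
  from choice[OF this] obtain J where "\<forall>n. \<exists>c. finite (J n) \<and> J n \<subseteq> {i \<in> I. wt i = n} \<and>
    c \<in> J n \<rightarrow> K \<and> f n = (\<Oplus>i\<in>J n. c i \<otimes> e i)" ..
  from choice[OF this] obtain c where "\<forall>n. finite (J n) \<and> J n \<subseteq> {i \<in> I. wt i = n} \<and>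
    c n \<in> J n \<rightarrow> K \<and> f n = (\<Oplus>i\<in>J n. c n i \<otimes> e i)" ..
  then have J: "\<And>n. finite (J n)" "\<And>n. J n \<subseteq> {i \<in> I. wt i = n}"
    "\<And>n. c n \<in> J n \<rightarrow> K" and fn: "\<And>n. f n = (\<Oplus>i\<in>J n. c n i \<otimes> e i)"
    by simp_all
  let ?U = "\<Union>(J ` N)" and ?d = "\<lambda>i. c (wt i) i"
  have d: "?d i = c n i" if "i \<in> J n" for i n using J(2) that by blast
  have mem_n: "c n i \<otimes> e i \<in> carrier R" if "i \<in> J n" for i n
    by (rule mem[OF J(3)]) (use J(2) that in auto)
  have fn': "f n = (\<Oplus>i\<in>J n. ?d i \<otimes> e i)" for n
    unfolding fn by (rule finsum_cong') (use d mem_n in auto)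
  have U: "finite ?U" "?U \<subseteq> I" using J(1,2) N by blast+
  have dK: "?d \<in> ?U \<rightarrow> K"
  proof
    fix i assume "i \<in> ?U"
    then obtain n where "i \<in> J n" by blast
    then show "?d i \<in> K" using d Pi_mem[OF J(3)] by simp
  qed
  have "(\<Oplus>i\<in>?U. ?d i \<otimes> e i) = (\<Oplus>n\<in>N. \<Oplus>i\<in>J n. ?d i \<otimes> e i)"
  proof (rule add.finprod_UN_disjoint[OF N])
    show "pairwise (\<lambda>m n. disjnt (J m) (J n)) N"
      using J(2) unfolding pairwise_def disjnt_def by blast
    show "?d i \<otimes> e i \<in> carrier R" if "i \<in> J n" for i n using that d mem_n by simp
  qed (rule J(1))
  also have "\<dots> = \<zero>" using s0 by (simp only: fn')
  finally have zero: "?d i = \<zero>" if "i \<in> ?U" for i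
    using left_independentD[OF ind U dK _ that] by blast
  have "?d i \<otimes> e i = \<zero>" if "i \<in> J n" for i
  proof -
    have "e i \<in> carrier R" using that J(2) e by blast
    moreover have "?d i = \<zero>" using zero that n by blast
    ultimately show ?thesis by simp
  qed
  then show "f n = \<zero>" unfolding fn' by (rule add.finprod_one_eqI)
qed

text \<open>Together with the induction principle for left spans this shows that the span of homogeneous
  elements of degree at most \<open>k\<close> is contained in \<open>sum_upto R B k\<close>.\<close>
lemma sum_upto_additive:
  assumes sub: "\<And>n. additive_subgroup (B n) R"
  shows "\<zero> \<in> sum_upto R B k"
    and "\<lbrakk>a \<in> sum_upto R B k; b \<in> sum_upto R B k\<rbrakk> \<Longrightarrow> a \<oplus> b \<in> sum_upto R B k"
    and "sum_upto R B k \<subseteq> carrier R"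
    and "n \<le> k \<Longrightarrow> B n \<subseteq> sum_upto R B k"
proof -
  note B = additive_subgroupE[OF sub]
  have car: "f i \<in> carrier R" if "f \<in> (\<Pi> i\<in>{..k}. B i)" "i \<in> {..k}" for f i
    using Pi_mem[OF that] B(1) by blast
  have memI: "(\<Oplus>i\<in>{..k}. f i) \<in> sum_upto R B k" if "f \<in> (\<Pi> i\<in>{..k}. B i)" for f
    using that unfolding sum_upto_def by blast
  have "(\<Oplus>i\<in>{..k}. \<zero>) \<in> sum_upto R B k" by (rule memI) (use B(2) in auto)
  then show "\<zero> \<in> sum_upto R B k" by simp
  show "sum_upto R B k \<subseteq> carrier R"
    using car unfolding sum_upto_def by (auto intro!: finsum_closed)
  show "a \<oplus> b \<in> sum_upto R B k" if ab: "a \<in> sum_upto R B k" "b \<in> sum_upto R B k"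
  proof -
    obtain f where f: "f \<in> (\<Pi> i\<in>{..k}. B i)" "a = (\<Oplus>i\<in>{..k}. f i)"
      using ab(1) by (auto simp: sum_upto_def)
    obtain g where g: "g \<in> (\<Pi> i\<in>{..k}. B i)" "b = (\<Oplus>i\<in>{..k}. g i)"
      using ab(2) by (auto simp: sum_upto_def)
    have "a \<oplus> b = (\<Oplus>i\<in>{..k}. f i \<oplus> g i)"
      unfolding f g by (rule finsum_addf[symmetric]) (use car[OF f(1)] car[OF g(1)] in auto)
    also have "\<dots> \<in> sum_upto R B k"
      by (rule memI) (use B(3) Pi_mem[OF f(1)] Pi_mem[OF g(1)] in auto)
    finally show ?thesis .
  qed
  show "B n \<subseteq> sum_upto R B k" if "n \<le> k"
  proof
    fix b assume b: "b \<in> B n"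
    have "b \<in> carrier R" using b B(1) by blast
    then have "b = (\<Oplus>i\<in>{..k}. if n = i then b else \<zero>)"
      using that finsum_singleton[of n "{..k}" "\<lambda>_. b"] by simp
    also have "\<dots> \<in> sum_upto R B k" by (rule memI) (use b B(2) in auto)
    finally show "b \<in> sum_upto R B k" .
  qed
qed

section \<open>Graded rings\<close>

text \<open>Let \<open>u\<^sub>n\<close> be the components of \<open>1\<close>. For homogeneous \<open>b\<close>
  of degree \<open>m\<close> the equation \<open>b = \<Sum>\<^sub>n b u\<^sub>n\<close> is a decomposition into
  components, so its part of degree \<open>m\<close> is \<open>b = b u\<^sub>0\<close>. Summing over the
  components of \<open>1\<close> gives \<open>1 = 1 u\<^sub>0 = u\<^sub>0\<close>.\<close>
lemma graded_ring_one:
  assumes gr: "graded_ring R B"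
  shows "\<one> \<in> B 0"
proof -
  have B: "internal_direct_sum R B" and mult: "\<And>m n. B m <#> B n \<subseteq> B (m + n)"
    using gr by (auto simp: graded_ring_def)
  note sub = additive_subgroupE[OF internal_direct_sum_subgroup[OF B]]
  have car: "b \<in> carrier R" if "b \<in> B n" for b n using sub(1) that by blast
  have mult': "a \<otimes> b \<in> B (m + n)" if "a \<in> B m" "b \<in> B n" for a b m n
    using mult[of m n] that by (auto simp: set_mult_def subset_iff)
  obtain u N where u: "\<And>n. u n \<in> B n" "finite N" "\<And>n. n \<notin> N \<Longrightarrow> u n = \<zero>" "\<one> = (\<Oplus>n\<in>N. u n)"
    using internal_direct_sum_decompose[OF B one_closed] by blast
  have u_mem: "u n \<in> carrier R" for n using car u(1) .
  have hom: "b = b \<otimes> u 0" if b: "b \<in> B m" for b m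
  proof -
    let ?N = "insert 0 N"
    let ?t = "\<lambda>n. b \<otimes> u n"
    have b_mem: "b \<in> carrier R" using car b .
    have "b = b \<otimes> (\<Oplus>n\<in>?N. u n)"
    proof -
      have "(\<Oplus>n\<in>?N. u n) = \<one>"
        unfolding u(4)
        by (rule add.finprod_mono_neutral_cong_right) (use u(2,3) u_mem in auto)
      then show ?thesis using b_mem by simp
    qed
    also have "\<dots> = (\<Oplus>n\<in>?N. ?t n)"
      by (rule finsum_rdistr) (use u(2) u_mem b_mem in auto)
    finally have b_eq: "b = (\<Oplus>n\<in>?N. ?t n)" .
    have "(\<Oplus>n\<in>?N. ?t n) = (\<Oplus>n\<in>{n \<in> ?N. m + n = m}. ?t n)"
      by (rule homogeneous_part[OF B, where wt = "\<lambda>n. m + n"])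
        (use u mult'[OF b] b b_eq in auto)
    also have "{n \<in> ?N. m + n = m} = {0}" by auto
    also have "(\<Oplus>n\<in>{0}. ?t n) = b \<otimes> u 0" using u_mem b_mem by simp
    finally show ?thesis using b_eq by simp
  qed
  have "\<one> = (\<Oplus>n\<in>N. u n \<otimes> u 0)"
    unfolding u(4) by (rule finsum_cong') (use u_mem hom[OF u(1)] in auto)
  also have "\<dots> = (\<Oplus>n\<in>N. u n) \<otimes> u 0"
    by (rule finsum_ldistr[symmetric]) (use u(2) u_mem in auto)
  also have "\<dots> = u 0" using u(4) u_mem by (simp flip: u(4))
  finally show ?thesis using u(1) by simp
qed

lemma graded_ring_imp_semi_graded:
  assumes gr: "graded_ring R B"
  shows "semi_graded R B"
proof -
  have B: "internal_direct_sum R B" and mult: "\<And>m n. B m <#> B n \<subseteq> B (m + n)"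
    using gr by (auto simp: graded_ring_def)
  have "B m <#> B n \<subseteq> sum_upto R B (m + n)" for m n
    by (rule subset_trans[OF mult sum_upto_additive(4)[of B, OF internal_direct_sum_subgroup[OF B]]]) simp
  then show ?thesis
    using B graded_ring_one[OF gr] ring_axioms by (simp add: semi_graded_def)
qed

end


section \<open>Products of words\<close>

definition (in ring) word_product :: "('i \<Rightarrow> 'a) \<Rightarrow> 'i list \<Rightarrow> 'a" where
  "word_product h w = foldr (\<lambda>i m. h i \<otimes> m) w \<one>"

context ring
begin

lemma word_product_simps [simp]:
  "word_product h [] = \<one>"
  "word_product h (i # w) = h i \<otimes> word_product h w"
  by (simp_all add: word_product_def)

lemma word_product_closed:
  assumes "h \<in> I \<rightarrow> carrier R" "w \<in> lists I"
  shows "word_product h w \<in> carrier R"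
  using assms(2) by induction (use assms(1) in auto)

lemma word_product_append:
  assumes "h \<in> I \<rightarrow> carrier R" "v \<in> lists I" "w \<in> lists I"
  shows "word_product h (v @ w) = word_product h v \<otimes> word_product h w"
  using assms(2)
proof induction
  case (Cons i v)
  then have "h i \<in> carrier R" "word_product h v \<in> carrier R"
    using assms(1) word_product_closed[OF assms(1)] by auto
  then show ?case using Cons word_product_closed[OF assms(1,3)] by (simp add: m_assoc)
qed (simp add: word_product_closed[OF assms(1,3)])

text \<open>Central coefficients can be pulled out of a product, and what remains of a product of two words is
  their concatenation.\<close>
lemma left_span_words_subring:
  assumes K: "subring K R" and central: "\<And>k a. \<lbrakk>k \<in> K; a \<in> carrier R\<rbrakk> \<Longrightarrow> k \<otimes> a = a \<otimes> k"
    and h: "h \<in> I \<rightarrow> carrier R"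
  shows "subring (left_span K (lists I) (word_product h)) R" (is "subring ?T R")
proof -
  have wp: "word_product h \<in> lists I \<rightarrow> carrier R" using word_product_closed[OF h] by blast
  note T = additive_subgroupE[OF left_span_additive_subgroup[OF K wp]]
  have T_car: "a \<in> carrier R" if "a \<in> ?T" for a using T(1) that by blast
  have K_car: "k \<in> carrier R" if "k \<in> K" for k using subringE(1)[OF K] that by blast
  have word_mult: "word_product h v \<otimes> b \<in> ?T" if v: "v \<in> lists I" and b: "b \<in> ?T" for v b
  proof -
    have v_car: "word_product h v \<in> carrier R" using Pi_mem[OF wp v] .
    have "?T \<subseteq> {b \<in> carrier R. word_product h v \<otimes> b \<in> ?T}"
    proof (rule left_span_minimal)
      fix w k assume w: "w \<in> lists I" and k: "k \<in> K"
      have w_car: "word_product h w \<in> carrier R" using Pi_mem[OF wp w] .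
      have "word_product h v \<otimes> (k \<otimes> word_product h w)
          = (word_product h v \<otimes> k) \<otimes> word_product h w"
        using v_car w_car K_car[OF k] by (simp add: m_assoc)
      also have "word_product h v \<otimes> k = k \<otimes> word_product h v"
        using central[OF k v_car] by simp
      also have "(k \<otimes> word_product h v) \<otimes> word_product h w = k \<otimes> word_product h (v @ w)"
        using v_car w_car K_car[OF k] word_product_append[OF h v w] by (simp add: m_assoc)
      also have "\<dots> \<in> ?T"
        by (rule left_span_generator[OF K wp _ k]) (use v w in auto)
      finally show "k \<otimes> word_product h w \<in> {b \<in> carrier R. word_product h v \<otimes> b \<in> ?T}"
        using w_car K_car[OF k] by simp
    qed (use T v_car in \<open>auto simp: r_distr\<close>)
    then show ?thesis using b by blast
  qed
  have mult: "a \<otimes> b \<in> ?T" if a: "a \<in> ?T" and b: "b \<in> ?T" for a b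
  proof -
    have b_car: "b \<in> carrier R" using T_car[OF b] .
    have "?T \<subseteq> {a \<in> carrier R. a \<otimes> b \<in> ?T}"
    proof (rule left_span_minimal)
      fix v k assume v: "v \<in> lists I" and k: "k \<in> K"
      have v_car: "word_product h v \<in> carrier R" using Pi_mem[OF wp v] .
      have "k \<otimes> (word_product h v \<otimes> b) \<in> ?T"
        by (rule left_span_smult[OF K wp k word_mult[OF v b]])
      then show "k \<otimes> word_product h v \<in> {a \<in> carrier R. a \<otimes> b \<in> ?T}"
        using v_car b_car K_car[OF k] by (simp add: m_assoc)
    qed (use T b_car in \<open>auto simp: l_distr\<close>)
    then show ?thesis using a by blast
  qed
  show ?thesis
  proof (rule subringI)
    show "\<one> \<in> ?T" using left_span_incl[OF K wp, of "[]"] by simp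
  qed (use T mult in auto)
qed

section \<open>Finitely graded algebras\<close>

text \<open>The generators are replaced by their homogeneous components of positive degree; the components of
  degree \<open>0\<close> are scalars. All letters then have positive degree, so a word of degree
  \<open>n\<close> has at most \<open>n\<close> letters, and finitely many words span
  \<open>B n\<close>.\<close>
lemma finitely_graded_algebra_imp_finitely_semi_graded:
  assumes fga: "finitely_graded_algebra K R B"
  shows "finitely_semi_graded R B"
proof -
  have Kf: "subfield K R" and gr: "graded_ring R B" and B0: "B 0 = K"
    and central: "\<And>k a. \<lbrakk>k \<in> K; a \<in> carrier R\<rbrakk> \<Longrightarrow> k \<otimes> a = a \<otimes> k"
    using fga by (auto simp: finitely_graded_algebra_def)
  note K = subfieldE(1)[OF Kf]
  obtain X where X: "finite X" "X \<subseteq> carrier R" "generate_ring R (K \<union> X) = carrier R"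
    using fga unfolding finitely_graded_algebra_def by blast
  have B: "internal_direct_sum R B" and mult: "\<And>m n. B m <#> B n \<subseteq> B (m + n)"
    using gr by (auto simp: graded_ring_def)
  have mult': "a \<otimes> b \<in> B (m + n)" if "a \<in> B m" "b \<in> B n" for a b m n
    using mult[of m n] that by (auto simp: set_mult_def subset_iff)
  note sub = additive_subgroupE[OF internal_direct_sum_subgroup[OF B]]
  have car: "b \<in> carrier R" if "b \<in> B n" for b n using sub(1) that by blast
  have "\<forall>x\<in>X. \<exists>p. (\<forall>n. fst p n \<in> B n) \<and> finite (snd p) \<and> x = (\<Oplus>n\<in>snd p. fst p n)"
  proof
    fix x assume "x \<in> X"
    then have "x \<in> carrier R" using X(2) by blast
    from internal_direct_sum_decompose[OF B this] obtain f N
      where "\<And>n. f n \<in> B n" "finite N" "\<And>n. n \<notin> N \<Longrightarrow> f n = \<zero>" "x = (\<Oplus>n\<in>N. f n)"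
      by blast
    then show "\<exists>p. (\<forall>n. fst p n \<in> B n) \<and> finite (snd p) \<and> x = (\<Oplus>n\<in>snd p. fst p n)"
      by (intro exI[of _ "(f, N)"]) simp
  qed
  from bchoice[OF this] obtain p where
    "\<forall>x\<in>X. (\<forall>n. fst (p x) n \<in> B n) \<and> finite (snd (p x)) \<and> x = (\<Oplus>n\<in>snd (p x). fst (p x) n)" ..
  then have p: "\<And>x n. x \<in> X \<Longrightarrow> fst (p x) n \<in> B n" "\<And>x. x \<in> X \<Longrightarrow> finite (snd (p x))"
    "\<And>x. x \<in> X \<Longrightarrow> x = (\<Oplus>n\<in>snd (p x). fst (p x) n)" by blast+
  \<comment> \<open>A letter \<open>(x, n)\<close> stands for the component of degree \<open>n\<close> of the generator \<open>x\<close>;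
    pairing it with \<open>n\<close> gives a degree even to a component that is zero.\<close>
  define P where "P = Sigma X (\<lambda>x. snd (p x) - {0})"
  define h where "h = (\<lambda>(x, n). fst (p x) n)"
  define wt :: "('a \<times> nat) list \<Rightarrow> nat" where "wt w = sum_list (map snd w)" for w
  have P_fin: "finite P" using X(1) p(2) by (simp add: P_def)
  have h_B: "h q \<in> B (snd q)" if "q \<in> P" for q using that p(1) by (auto simp: P_def h_def)
  have h: "h \<in> P \<rightarrow> carrier R" using h_B car by blast
  let ?wp = "word_product h"
  have wp: "?wp \<in> lists P \<rightarrow> carrier R" using word_product_closed[OF h] by blast
  let ?T = "left_span K (lists P) ?wp"
  have T_ring: "subring ?T R" by (rule left_span_words_subring[OF K central h])
  have K_T: "k \<in> ?T" if "k \<in> K" for k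
    using left_span_generator[OF K wp, of "[]" k] that subringE(1)[OF K] by auto
  have X_T: "x \<in> ?T" if x: "x \<in> X" for x
  proof -
    have "(\<Oplus>n\<in>snd (p x). fst (p x) n) \<in> ?T"
    proof (rule finsum_mem)
      show "fst (p x) \<in> snd (p x) \<rightarrow> ?T"
      proof
        fix n assume n: "n \<in> snd (p x)"
        show "fst (p x) n \<in> ?T"
        proof (cases "n = 0")
          case True
          then show ?thesis using K_T p(1)[OF x, of 0] B0 by simp
        next
          case False
          then have q: "(x, n) \<in> P" using x n by (simp add: P_def)
          then have "?wp [(x, n)] \<in> ?T" by (intro left_span_incl[OF K wp]) simp
          moreover have "?wp [(x, n)] = fst (p x) n"
            using car[OF p(1)[OF x]] by (simp add: h_def)
          ultimately show ?thesis by simp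
        qed
      qed
    qed (use subringE[OF T_ring] in auto)
    then show ?thesis using p(3)[OF x] by simp
  qed
  \<comment> \<open>The words span the whole ring, because their span is a subring that contains the generators.\<close>
  have "generate_ring R (K \<union> X) \<subseteq> ?T"
    by (rule generate_ring_min_subring1[OF _ T_ring]) (use subringE(1)[OF K] X(2) K_T X_T in auto)
  then have T_all: "a \<in> ?T" if "a \<in> carrier R" for a using that X(3) by blast
  have wp_B: "?wp w \<in> B (wt w)" if "w \<in> lists P" for w
    using that
  proof induction
    case Nil
    show ?case using graded_ring_one[OF gr] by (simp add: wt_def)
  next
    case (Cons q w)
    then show ?case using mult'[OF h_B Cons(3)] by (simp add: wt_def)
  qed
  have kwp_B: "k \<otimes> ?wp w \<in> B (wt w)" if "w \<in> lists P" "k \<in> K" for w k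
    using mult'[of k 0 "?wp w" "wt w"] wp_B that B0 by simp
  let ?W = "\<lambda>n. {w \<in> lists P. wt w = n}"
  have W_fin: "finite (?W n)" for n
  proof -
    have len: "length w \<le> wt w" if "w \<in> lists P" for w
      using that
    proof induction
      case (Cons q w)
      moreover have "0 < snd q" using Cons(1) by (auto simp: P_def)
      ultimately show ?case by (simp add: wt_def)
    qed (simp add: wt_def)
    have "?W n \<subseteq> {w. set w \<subseteq> P \<and> length w \<le> n}" using len by (auto simp: lists_eq_set)
    then show ?thesis using finite_lists_length_le[OF P_fin] by (rule finite_subset)
  qed
  have B_span: "B n = left_span K (?W n) ?wp" for n
  proof
    show "left_span K (?W n) ?wp \<subseteq> B n"
    proof (rule left_span_minimal)
      show "k \<otimes> ?wp w \<in> B n" if "w \<in> ?W n" "k \<in> K" for w k using kwp_B[of w k] that by simp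
    qed (use sub in auto)
    show "B n \<subseteq> left_span K (?W n) ?wp"
    proof
      fix b assume b: "b \<in> B n"
      have "b \<in> ?T" by (rule T_all[OF car[OF b]])
      then obtain J c where J: "finite J" "J \<subseteq> lists P" "c \<in> J \<rightarrow> K"
        and b_eq: "b = (\<Oplus>w\<in>J. c w \<otimes> ?wp w)"
        by (rule left_spanE)
      have "c w \<otimes> ?wp w \<in> B (wt w)" if "w \<in> J" for w
        using kwp_B[OF subsetD[OF J(2) that] Pi_mem[OF J(3) that]] .
      from homogeneous_part[OF B J(1) this b[unfolded b_eq]]
      have "b = (\<Oplus>w\<in>{w \<in> J. wt w = n}. c w \<otimes> ?wp w)" unfolding b_eq .
      also have "\<dots> \<in> left_span K (?W n) ?wp"
        by (rule left_span_mem) (use J in auto)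
      finally show "b \<in> left_span K (?W n) ?wp" .
    qed
  qed
  have "\<exists>d. free_of_dim (R\<lparr>carrier := B 0\<rparr>) (mult_module R (B n)) d" for n
    unfolding B0 B_span[of n] by (rule free_of_dim_subfield[OF Kf W_fin]) (use wp in auto)
  then show ?thesis
    using X B0 graded_ring_imp_semi_graded[OF gr] unfolding finitely_semi_graded_def by blast
qed

end


section \<open>Sorted words and exponents\<close>

text \<open>The word whose product is the monomial with exponent \<open>\<alpha>\<close>. Monomials are handled
  as sorted words because multiplying by a variable then means inserting a letter.\<close>
definition exponent_word :: "nat \<Rightarrow> (nat \<Rightarrow> nat) \<Rightarrow> nat list" where
  "exponent_word n \<alpha> = concat (map (\<lambda>i. replicate (\<alpha> i) i) [1..<Suc n])"

definition sorted_words :: "nat \<Rightarrow> nat list set" where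
  "sorted_words n = {w \<in> lists {1..n}. sorted w}"

lemma sorted_concat_replicate:
  "sorted ks \<Longrightarrow> sorted (concat (map (\<lambda>i. replicate (\<alpha> i) i) ks))"
  by (induction ks) (auto simp: sorted_append)

lemma count_list_concat_replicate:
  "distinct ks \<Longrightarrow>
    count_list (concat (map (\<lambda>i. replicate (\<alpha> i) i) ks)) j = (if j \<in> set ks then \<alpha> j else 0)"
proof (induction ks)
  case (Cons i ks)
  have "count_list (replicate m i) j = (if j = i then m else 0)" for m
    by (induction m) auto
  with Cons show ?case by auto
qed simp

lemma exponent_word_sorted: "exponent_word n \<alpha> \<in> sorted_words n"
proof -
  have "sorted (exponent_word n \<alpha>)"
    unfolding exponent_word_def by (rule sorted_concat_replicate) (simp del: upt_Suc)
  then show ?thesis by (auto simp: exponent_word_def sorted_words_def)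
qed

lemma length_exponent_word: "length (exponent_word n \<alpha>) = (\<Sum>i\<in>{1..n}. \<alpha> i)"
proof -
  have "length (exponent_word n \<alpha>) = (\<Sum>i\<leftarrow>[1..<Suc n]. \<alpha> i)"
    by (simp add: exponent_word_def length_concat comp_def del: upt_Suc)
  also have "\<dots> = (\<Sum>i\<in>{1..n}. \<alpha> i)"
    by (subst sum_list_distinct_conv_sum_set) (simp_all del: upt_Suc add: atLeastLessThanSuc_atLeastAtMost)
  finally show ?thesis .
qed

text \<open>A sorted list is determined by the multiplicities of its entries.\<close>
lemma sorted_word_eq_exponent_word:
  assumes w: "w \<in> sorted_words n"
  shows "w = exponent_word n (\<lambda>i\<in>{1..n}. count_list w i)"
proof -
  have "count_list (exponent_word n (\<lambda>i\<in>{1..n}. count_list w i)) j = count_list w j" for j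
    using w count_list_0_iff[of w j]
    by (auto simp: exponent_word_def count_list_concat_replicate sorted_words_def simp del: upt_Suc)
  then have "mset (exponent_word n (\<lambda>i\<in>{1..n}. count_list w i)) = mset w"
    by (intro multiset_eqI) (simp add: count_mset)
  then show ?thesis
    using w exponent_word_sorted[of n "\<lambda>i\<in>{1..n}. count_list w i"]
    by (metis (no_types, lifting) mem_Collect_eq properties_for_sort sorted_words_def)
qed

lemma exponent_word_image:
  "exponent_word n ` {\<alpha> \<in> exponents n. (\<Sum>i\<in>{1..n}. \<alpha> i) = k} = {w \<in> sorted_words n. length w = k}"
proof
  show "exponent_word n ` {\<alpha> \<in> exponents n. (\<Sum>i\<in>{1..n}. \<alpha> i) = k}
      \<subseteq> {w \<in> sorted_words n. length w = k}"
    using exponent_word_sorted length_exponent_word by auto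
  show "{w \<in> sorted_words n. length w = k}
      \<subseteq> exponent_word n ` {\<alpha> \<in> exponents n. (\<Sum>i\<in>{1..n}. \<alpha> i) = k}"
  proof
    fix w assume "w \<in> {w \<in> sorted_words n. length w = k}"
    then have w: "w \<in> sorted_words n" "length w = k" by auto
    let ?\<alpha> = "\<lambda>i\<in>{1..n}. count_list w i"
    have eq: "w = exponent_word n ?\<alpha>" by (rule sorted_word_eq_exponent_word[OF w(1)])
    have "?\<alpha> \<in> exponents n" by (simp add: exponents_def)
    moreover have "(\<Sum>i\<in>{1..n}. ?\<alpha> i) = k"
      using length_exponent_word[of n ?\<alpha>] eq w(2) by metis
    ultimately show "w \<in> exponent_word n ` {\<alpha> \<in> exponents n. (\<Sum>i\<in>{1..n}. \<alpha> i) = k}"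
      using eq by blast
  qed
qed

lemma finite_exponents_of_degree: "finite {\<alpha> \<in> exponents n. (\<Sum>i\<in>{1..n}. \<alpha> i) = k}"
proof (rule finite_subset)
  show "{\<alpha> \<in> exponents n. (\<Sum>i\<in>{1..n}. \<alpha> i) = k} \<subseteq> {1..n} \<rightarrow>\<^sub>E {..k}"
  proof
    fix \<alpha> assume \<alpha>: "\<alpha> \<in> {\<alpha> \<in> exponents n. (\<Sum>i\<in>{1..n}. \<alpha> i) = k}"
    then have "\<alpha> i \<le> k" if "i \<in> {1..n}" for i
      using member_le_sum[OF that, of \<alpha>] by simp
    then show "\<alpha> \<in> {1..n} \<rightarrow>\<^sub>E {..k}" using \<alpha> by (auto simp: exponents_def PiE_iff)
  qed
qed (rule finite_PiE; simp)

context ring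
begin

lemma word_product_replicate_append:
  assumes "x \<in> I \<rightarrow> carrier R" "i \<in> I" "w \<in> lists I"
  shows "word_product x (replicate m i @ w) = x i [^] m \<otimes> word_product x w"
proof (induction m)
  case 0
  show ?case using word_product_closed[OF assms(1,3)] by simp
next
  case (Suc m)
  have "x i \<in> carrier R" using Pi_mem[OF assms(1,2)] .
  moreover have "x i \<otimes> x i [^] m = x i [^] m \<otimes> x i"
    using nat_pow_Suc2[OF \<open>x i \<in> carrier R\<close>, of m] by simp
  ultimately show ?case using Suc word_product_closed[OF assms(1,3)]
    by (simp flip: m_assoc)
qed

lemma add_minus_cancel: "\<lbrakk>a \<in> carrier R; b \<in> carrier R\<rbrakk> \<Longrightarrow> a = b \<oplus> (a \<ominus> b)"
  by (simp add: a_minus_def a_lcomm[of b a] r_neg)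

lemma monomial_eq_word_product:
  assumes x: "x \<in> {1..n} \<rightarrow> carrier R"
  shows "monomial R n x \<alpha> = word_product x (exponent_word n \<alpha>)"
proof -
  have *: "foldr (\<lambda>i m. (x i [^] \<alpha> i) \<otimes> m) ks \<one>
      = word_product x (concat (map (\<lambda>i. replicate (\<alpha> i) i) ks))" if "set ks \<subseteq> {1..n}" for ks
    using that
  proof (induction ks)
    case (Cons i ks)
    have "concat (map (\<lambda>i. replicate (\<alpha> i) i) ks) \<in> lists {1..n}" using Cons(2) by auto
    then show ?case using Cons word_product_replicate_append[OF x] by simp
  qed simp
  show ?thesis
    unfolding monomial_def exponent_word_def by (rule *) auto
qed

end

section \<open>Skew PBW extensions\<close>

locale skew_PBW = ring R for R (structure) +
  fixes K :: "'a set" and n :: nat and x :: "nat \<Rightarrow> 'a"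
  assumes skew_PBW: "skew_PBW_extension R K n x"
begin

lemma K: "subring K R" and x: "x \<in> {1..n} \<rightarrow> carrier R"
  using skew_PBW by (auto simp: skew_PBW_extension_def)

lemma K_carrier: "k \<in> K \<Longrightarrow> k \<in> carrier R"
  using subringE(1)[OF K] by blast

lemma x_carrier: "i \<in> {1..n} \<Longrightarrow> x i \<in> carrier R"
  using x by auto

lemma word_carrier: "w \<in> sorted_words n \<Longrightarrow> word_product x w \<in> carrier R"
  by (rule word_product_closed[OF x]) (simp add: sorted_words_def)

lemma monomial_carrier: "monomial R n x \<alpha> \<in> carrier R"
  unfolding monomial_eq_word_product[OF x] by (rule word_carrier) (rule exponent_word_sorted)

lemma monomial_basis:
  "left_span K (exponents n) (monomial R n x) = carrier R"
  "left_independent K (exponents n) (monomial R n x)"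
proof -
  have "additive_subgroup (carrier R) R"
    by (intro additive_subgroupI add.subgroupI) auto
  then have "basis_family (R\<lparr>carrier := K\<rparr>) (mult_module R (carrier R)) (exponents n) (monomial R n x) \<longleftrightarrow>
    monomial R n x \<in> exponents n \<rightarrow> carrier R \<and>
    carrier R = left_span K (exponents n) (monomial R n x) \<and>
    left_independent K (exponents n) (monomial R n x)"
    by (rule basis_family_mult_module_iff[OF K]) (simp add: K_carrier)
  then show "left_span K (exponents n) (monomial R n x) = carrier R"
    "left_independent K (exponents n) (monomial R n x)"
    using skew_PBW by (simp_all add: skew_PBW_extension_def)
qed

text \<open>The defining condition speaks of nonzero scalars; the zero scalar passes with
  \<open>c = r = 0\<close>.\<close>
lemma variable_past_scalar:
  assumes i: "i \<in> {1..n}" and k: "k \<in> K"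
  obtains c r where "c \<in> K" "r \<in> K" "x i \<otimes> k = c \<otimes> x i \<oplus> r"
proof (cases "k = \<zero>")
  case True
  then show ?thesis using that[of \<zero> \<zero>] subringE(2)[OF K] x_carrier[OF i] by simp
next
  case False
  then obtain c where c: "c \<in> K" "x i \<otimes> k \<ominus> c \<otimes> x i \<in> K"
    using skew_PBW i k unfolding skew_PBW_extension_def by blast
  have "x i \<otimes> k = c \<otimes> x i \<oplus> (x i \<otimes> k \<ominus> c \<otimes> x i)"
    by (rule add_minus_cancel) (use c(1) k x_carrier[OF i] K_carrier in auto)
  with c show ?thesis by (rule that)
qed

lemma variable_past_variable:
  assumes i: "i \<in> {1..n}" and j: "j \<in> {1..n}"
  obtains c r0 r where "c \<in> K" "r0 \<in> K" "r \<in> {1..n} \<rightarrow> K"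
    "x i \<otimes> x j = c \<otimes> x j \<otimes> x i \<oplus> (r0 \<oplus> (\<Oplus>k\<in>{1..n}. r k \<otimes> x k))"
proof -
  have "\<exists>c\<in>K - {\<zero>}. \<exists>r0\<in>K. \<exists>r\<in>{1..n} \<rightarrow> K.
    x i \<otimes> x j \<ominus> c \<otimes> x j \<otimes> x i = r0 \<oplus> (\<Oplus>k\<in>{1..n}. r k \<otimes> x k)"
    using skew_PBW i j unfolding skew_PBW_extension_def by simp
  then obtain c r0 r where c: "c \<in> K" "r0 \<in> K" "r \<in> {1..n} \<rightarrow> K"
    and eq: "x i \<otimes> x j \<ominus> c \<otimes> x j \<otimes> x i = r0 \<oplus> (\<Oplus>k\<in>{1..n}. r k \<otimes> x k)" by blast
  have "x i \<otimes> x j = c \<otimes> x j \<otimes> x i \<oplus> (x i \<otimes> x j \<ominus> c \<otimes> x j \<otimes> x i)"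
    by (rule add_minus_cancel) (use c(1) x_carrier[OF i] x_carrier[OF j] K_carrier in auto)
  with c show ?thesis unfolding eq by (rule that)
qed

text \<open>Unlike the components, this filtration is multiplicative. It is spanned by sorted words only; that
  other words of length at most \<open>k\<close> belong to it as well is the content of the sorting argument
  below.\<close>
definition filtration :: "nat \<Rightarrow> 'a set" where
  "filtration k = left_span K {w \<in> sorted_words n. length w \<le> k} (word_product x)"

lemma words_carrier: "word_product x \<in> {w \<in> sorted_words n. length w \<le> k} \<rightarrow> carrier R"
  using word_carrier by blast

lemmas filtration_additive =
  additive_subgroupE[OF left_span_additive_subgroup[OF K words_carrier], folded filtration_def]

lemmas filtration_smult = left_span_smult[OF K words_carrier, folded filtration_def]

lemma filtration_carrier: "a \<in> filtration k \<Longrightarrow> a \<in> carrier R"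
  using filtration_additive(1) by blast

lemma filtration_mono: "k \<le> l \<Longrightarrow> filtration k \<subseteq> filtration l"
  unfolding filtration_def by (rule left_span_mono) auto

lemma filtration_word:
  assumes "w \<in> sorted_words n" "length w \<le> k"
  shows "word_product x w \<in> filtration k"
  unfolding filtration_def by (rule left_span_incl[OF K words_carrier]) (use assms in simp)

lemma filtration_minimal:
  assumes "\<zero> \<in> H" "\<And>a b. \<lbrakk>a \<in> H; b \<in> H\<rbrakk> \<Longrightarrow> a \<oplus> b \<in> H" "H \<subseteq> carrier R"
    and "\<And>w c. \<lbrakk>w \<in> sorted_words n; length w \<le> k; c \<in> K\<rbrakk> \<Longrightarrow> c \<otimes> word_product x w \<in> H"
  shows "filtration k \<subseteq> H"
  unfolding filtration_def by (rule left_span_minimal) (use assms in auto)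

text \<open>Multiplying the monomial of a sorted word by a variable inserts that variable at its place, up to a
  left coefficient and monomials of no greater length than the original word.\<close>
definition insertion_law :: "nat list \<Rightarrow> bool" where
  "insertion_law w \<longleftrightarrow> (\<forall>i\<in>{1..n}. \<exists>c\<in>K. \<exists>f\<in>filtration (length w).
     x i \<otimes> word_product x w = c \<otimes> word_product x (insort i w) \<oplus> f)"

lemma insort_sorted_words: "\<lbrakk>i \<in> {1..n}; w \<in> sorted_words n\<rbrakk> \<Longrightarrow> insort i w \<in> sorted_words n"
  by (auto simp: sorted_words_def sorted_insort set_insort_key lists_eq_set)

text \<open>A variable raises the filtration by at most one step: it passes a scalar with an error in
  \<open>K\<close>, and the insertion law takes care of its product with a word. The law is a hypothesis because
  its own proof by induction applies this lemma to shorter words.\<close>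
lemma variable_filtration:
  assumes law: "\<And>w. \<lbrakk>w \<in> sorted_words n; length w \<le> k\<rbrakk> \<Longrightarrow> insertion_law w"
    and i: "i \<in> {1..n}" and a: "a \<in> filtration k"
  shows "x i \<otimes> a \<in> filtration (Suc k)"
proof -
  have "filtration k \<subseteq> {a \<in> carrier R. x i \<otimes> a \<in> filtration (Suc k)}"
  proof (rule filtration_minimal)
    fix w c assume w: "w \<in> sorted_words n" "length w \<le> k" and c: "c \<in> K"
    note car = word_carrier[OF w(1)] x_carrier[OF i] K_carrier
    obtain d r where d: "d \<in> K" "r \<in> K" and eq: "x i \<otimes> c = d \<otimes> x i \<oplus> r"
      using variable_past_scalar[OF i c] .
    obtain c' f where c': "c' \<in> K" "f \<in> filtration (length w)"
      and eq': "x i \<otimes> word_product x w = c' \<otimes> word_product x (insort i w) \<oplus> f"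
      using law[OF w] i unfolding insertion_law_def by blast
    have "x i \<otimes> word_product x w \<in> filtration (Suc k)"
      unfolding eq'
    proof (rule filtration_additive(3))
      have "word_product x (insort i w) \<in> filtration (Suc k)"
        by (rule filtration_word[OF insort_sorted_words[OF i w(1)]]) (use w(2) in simp)
      then show "c' \<otimes> word_product x (insort i w) \<in> filtration (Suc k)"
        by (rule filtration_smult[OF c'(1)])
      show "f \<in> filtration (Suc k)" using c'(2) filtration_mono[of "length w" "Suc k"] w(2) by auto
    qed
    then have "d \<otimes> (x i \<otimes> word_product x w) \<in> filtration (Suc k)"
      by (rule filtration_smult[OF d(1)])
    moreover have "word_product x w \<in> filtration (Suc k)"
      by (rule filtration_word[OF w(1)]) (use w(2) in simp)
    then have "r \<otimes> word_product x w \<in> filtration (Suc k)"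
      by (rule filtration_smult[OF d(2)])
    ultimately have "d \<otimes> (x i \<otimes> word_product x w) \<oplus> r \<otimes> word_product x w \<in> filtration (Suc k)"
      by (rule filtration_additive(3))
    also have "d \<otimes> (x i \<otimes> word_product x w) \<oplus> r \<otimes> word_product x w
        = (d \<otimes> x i \<oplus> r) \<otimes> word_product x w"
      using car d by (simp add: l_distr m_assoc)
    also have "\<dots> = x i \<otimes> (c \<otimes> word_product x w)"
      unfolding eq[symmetric] using car c by (simp add: m_assoc)
    finally show "c \<otimes> word_product x w \<in> {a \<in> carrier R. x i \<otimes> a \<in> filtration (Suc k)}"
      using car c by simp
  qed (use filtration_additive x_carrier[OF i] in \<open>auto simp: r_distr\<close>)
  then show ?thesis using a by blast
qed

text \<open>By induction on the length. Only a word \<open>j # v\<close> with \<open>j < i\<close> needs work.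
  There \<open>x\<^sub>i x\<^sub>j\<close> is replaced by \<open>c x\<^sub>j x\<^sub>i\<close> plus an error
  of degree at most one, whose product with \<open>v\<close> has length at most that of \<open>j # v\<close>.
  By induction \<open>x\<^sub>i v\<close> is a multiple \<open>d u\<close> of the sorted word \<open>u\<close>
  obtained by insertion, plus lower terms, and moving \<open>x\<^sub>j\<close> past \<open>d\<close> leaves a
  multiple of \<open>j # u\<close>, which is sorted.\<close>
lemma insertion_law_sorted_words: "w \<in> sorted_words n \<Longrightarrow> insertion_law w"
proof (induction w rule: length_induct)
  case (1 w)
  note w = 1(2)
  show ?case
    unfolding insertion_law_def
  proof
    fix i assume i: "i \<in> {1..n}"
    show "\<exists>c\<in>K. \<exists>f\<in>filtration (length w).
      x i \<otimes> word_product x w = c \<otimes> word_product x (insort i w) \<oplus> f"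
    proof (cases "\<exists>j v. w = j # v \<and> j < i")
      case False
      then have "insort i w = i # w" by (cases w) auto
      then have "x i \<otimes> word_product x w = \<one> \<otimes> word_product x (insort i w) \<oplus> \<zero>"
        using word_carrier[OF w] x_carrier[OF i] by simp
      then show ?thesis using subringE(3)[OF K] filtration_additive(2) by blast
    next
      case True
      then obtain j v where jv: "w = j # v" and "j < i" by blast
      have j: "j \<in> {1..n}" and v: "v \<in> sorted_words n"
        using w jv by (auto simp: sorted_words_def)
      have IH: "insertion_law u" if "u \<in> sorted_words n" "length u \<le> length v" for u
        using 1(1) that jv by auto
      note var = variable_filtration[OF IH]
      have len: "length w = Suc (length v)" using jv by simp
      note F = filtration_additive(3) filtration_smult
      let ?v = "word_product x v" and ?u = "word_product x (insort i v)"
      note sv = insort_sorted_words[OF i v]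
      note car = word_carrier[OF v] word_carrier[OF sv] x_carrier[OF i] x_carrier[OF j]
      have sjv: "insort i w = j # insort i v" using jv \<open>j < i\<close> by simp
      obtain c r0 r where c: "c \<in> K" "r0 \<in> K" "r \<in> {1..n} \<rightarrow> K"
        and swap: "x i \<otimes> x j = c \<otimes> x j \<otimes> x i \<oplus> (r0 \<oplus> (\<Oplus>k\<in>{1..n}. r k \<otimes> x k))"
        using variable_past_variable[OF i j] .
      obtain d f where d: "d \<in> K" and f: "f \<in> filtration (length v)"
        and ins: "x i \<otimes> ?v = d \<otimes> ?u \<oplus> f"
        using IH[OF v] i unfolding insertion_law_def by blast
      obtain d' s where d': "d' \<in> K" "s \<in> K" and past: "x j \<otimes> d = d' \<otimes> x j \<oplus> s"
        using variable_past_scalar[OF j d] .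
      have r_car: "r k \<otimes> x k \<in> carrier R" if "k \<in> {1..n}" for k
        using Pi_mem[OF c(3) that] x_carrier[OF that] K_carrier by simp
      let ?lin = "r0 \<oplus> (\<Oplus>k\<in>{1..n}. r k \<otimes> x k)"
      have sum_car: "(\<Oplus>k\<in>{1..n}. r k \<otimes> x k) \<in> carrier R"
        using r_car by (intro finsum_closed) blast
      note car' = car sum_car K_carrier[OF c(1)] K_carrier[OF c(2)] K_carrier[OF d]
        K_carrier[OF d'(1)] K_carrier[OF d'(2)] filtration_carrier[OF f]
      \<comment> \<open>The error terms of the exchange of \<open>x i\<close> and \<open>x j\<close>.\<close>
      have lin: "?lin \<otimes> ?v \<in> filtration (length w)"
      proof -
        have "(\<Oplus>k\<in>{1..n}. (r k \<otimes> x k) \<otimes> ?v) \<in> filtration (length w)"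
        proof (rule finsum_mem[OF filtration_additive(2,3,1)])
          show "(\<lambda>k. (r k \<otimes> x k) \<otimes> ?v) \<in> {1..n} \<rightarrow> filtration (length w)"
          proof
            fix k assume k: "k \<in> {1..n}"
            have "r k \<otimes> (x k \<otimes> ?v) \<in> filtration (length w)"
              unfolding len
              by (rule filtration_smult[OF Pi_mem[OF c(3) k]])
                (rule var[OF _ _ k filtration_word[OF v]]; simp)
            then show "(r k \<otimes> x k) \<otimes> ?v \<in> filtration (length w)"
              using Pi_mem[OF c(3) k] x_carrier[OF k] K_carrier car by (simp add: m_assoc)
          qed
        qed
        moreover have "(\<Oplus>k\<in>{1..n}. r k \<otimes> x k) \<otimes> ?v = (\<Oplus>k\<in>{1..n}. (r k \<otimes> x k) \<otimes> ?v)"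
          by (rule finsum_ldistr) (use r_car car in auto)
        moreover have "r0 \<otimes> ?v \<in> filtration (length w)"
          by (rule filtration_smult[OF c(2) filtration_word[OF v]]) (simp add: len)
        ultimately show ?thesis using F(1) car' by (simp add: l_distr)
      qed
      \<comment> \<open>The lower terms of the insertion of \<open>i\<close> into \<open>v\<close>, and the error of moving \<open>x j\<close> past \<open>d\<close>.\<close>
      have low: "s \<otimes> ?u \<oplus> x j \<otimes> f \<in> filtration (length w)"
      proof (rule F(1))
        show "s \<otimes> ?u \<in> filtration (length w)"
          by (rule filtration_smult[OF d'(2) filtration_word[OF sv]]) (simp add: len)
        show "x j \<otimes> f \<in> filtration (length w)"
          unfolding len by (rule var[OF _ _ j f])
      qed
      note low_car = filtration_carrier[OF low] filtration_carrier[OF lin]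
      have "x j \<otimes> (x i \<otimes> ?v) = (x j \<otimes> d) \<otimes> ?u \<oplus> x j \<otimes> f"
        unfolding ins using car' by (simp add: r_distr m_assoc)
      also have "\<dots> = d' \<otimes> (x j \<otimes> ?u) \<oplus> (s \<otimes> ?u \<oplus> x j \<otimes> f)"
        unfolding past using car' by (simp add: l_distr m_assoc a_assoc)
      finally have inner: "x j \<otimes> (x i \<otimes> ?v) = d' \<otimes> (x j \<otimes> ?u) \<oplus> (s \<otimes> ?u \<oplus> x j \<otimes> f)" .
      have "x i \<otimes> word_product x w = (x i \<otimes> x j) \<otimes> ?v"
        unfolding jv using car by (simp add: m_assoc)
      also have "\<dots> = c \<otimes> (x j \<otimes> (x i \<otimes> ?v)) \<oplus> ?lin \<otimes> ?v"
      proof -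
        have "(x i \<otimes> x j) \<otimes> ?v = (c \<otimes> x j \<otimes> x i) \<otimes> ?v \<oplus> ?lin \<otimes> ?v"
          unfolding swap by (rule l_distr) (use car' in auto)
        then show ?thesis using car' by (simp add: m_assoc)
      qed
      also have "\<dots> = (c \<otimes> d') \<otimes> (x j \<otimes> ?u) \<oplus> (c \<otimes> (s \<otimes> ?u \<oplus> x j \<otimes> f) \<oplus> ?lin \<otimes> ?v)"
        unfolding inner using car' low_car by (simp add: r_distr[of _ _ c] m_assoc a_assoc)
      also have "x j \<otimes> ?u = word_product x (insort i w)" unfolding sjv by simp
      finally have "x i \<otimes> word_product x w = (c \<otimes> d') \<otimes> word_product x (insort i w) \<oplus>
        (c \<otimes> (s \<otimes> ?u \<oplus> x j \<otimes> f) \<oplus> ?lin \<otimes> ?v)" .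
      moreover have "c \<otimes> (s \<otimes> ?u \<oplus> x j \<otimes> f) \<oplus> ?lin \<otimes> ?v \<in> filtration (length w)"
        by (rule F(1)[OF filtration_smult[OF c(1) low] lin])
      moreover have "c \<otimes> d' \<in> K" using c(1) d'(1) subringE(6)[OF K] by blast
      ultimately show ?thesis by blast
    qed
  qed
qed

lemma word_filtration:
  assumes "w \<in> lists {1..n}" "a \<in> filtration k"
  shows "word_product x w \<otimes> a \<in> filtration (length w + k)"
  using assms(1)
proof induction
  case Nil
  show ?case using assms(2) filtration_carrier by simp
next
  case (Cons i w)
  have "x i \<otimes> (word_product x w \<otimes> a) \<in> filtration (Suc (length w + k))"
    by (rule variable_filtration[OF insertion_law_sorted_words Cons(1) Cons(3)])
  then show ?case
    using x_carrier[OF Cons(1)] word_product_closed[OF x Cons(2)] filtration_carrier[OF assms(2)]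
    by (simp add: m_assoc)
qed

text \<open>Multiplying \<open>b\<close> from the left by the letters of a word, the last letter first, raises
  the filtration by one step per letter; left coefficients do not raise it.\<close>
lemma filtration_mult:
  assumes a: "a \<in> filtration k" and b: "b \<in> filtration l"
  shows "a \<otimes> b \<in> filtration (k + l)"
proof -
  have b_car: "b \<in> carrier R" using filtration_carrier[OF b] .
  have "filtration k \<subseteq> {a \<in> carrier R. a \<otimes> b \<in> filtration (k + l)}"
  proof (rule filtration_minimal)
    fix w c assume w: "w \<in> sorted_words n" "length w \<le> k" and c: "c \<in> K"
    have "w \<in> lists {1..n}" using w(1) by (simp add: sorted_words_def)
    then have "word_product x w \<otimes> b \<in> filtration (k + l)"
      using word_filtration[OF _ b] filtration_mono[of "length w + l" "k + l"] w(2) by auto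
    then have "c \<otimes> (word_product x w \<otimes> b) \<in> filtration (k + l)"
      by (rule filtration_smult[OF c])
    then show "c \<otimes> word_product x w \<in> {a \<in> carrier R. a \<otimes> b \<in> filtration (k + l)}"
      using b_car word_carrier[OF w(1)] K_carrier[OF c] by (simp add: m_assoc)
  qed (use filtration_additive b_car in \<open>auto simp: l_distr\<close>)
  then show ?thesis using a by blast
qed

lemma PBW_component_eq_left_span:
  "PBW_component R K n x k = left_span K {\<alpha> \<in> exponents n. (\<Sum>i\<in>{1..n}. \<alpha> i) = k} (monomial R n x)"
  by (simp only: PBW_component_def left_span_def)

lemma PBW_component_eq_words:
  "PBW_component R K n x k = left_span K {w \<in> sorted_words n. length w = k} (word_product x)"
proof -
  have "monomial R n x = (\<lambda>\<alpha>. word_product x (exponent_word n \<alpha>))"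
    by (rule ext) (rule monomial_eq_word_product[OF x])
  moreover have "left_span K (exponent_word n ` {\<alpha> \<in> exponents n. (\<Sum>i\<in>{1..n}. \<alpha> i) = k}) (word_product x)
      = left_span K {\<alpha> \<in> exponents n. (\<Sum>i\<in>{1..n}. \<alpha> i) = k} (\<lambda>\<alpha>. word_product x (exponent_word n \<alpha>))"
    by (rule left_span_image[OF K]) (use word_carrier exponent_word_sorted in blast)
  ultimately show ?thesis
    unfolding PBW_component_eq_left_span exponent_word_image[symmetric] by simp
qed

lemma PBW_component_0: "PBW_component R K n x 0 = K"
proof -
  have "{w \<in> sorted_words n. length w = 0} = {[]}" by (auto simp: sorted_words_def)
  moreover have "left_span K {[]} (word_product x) = K"
    using left_span_finite[OF K, of "{[]}" "word_product x"] K_carrier by force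
  ultimately show ?thesis unfolding PBW_component_eq_words by simp
qed

lemma PBW_component_direct_sum: "internal_direct_sum R (PBW_component R K n x)"
proof -
  have "internal_direct_sum R (\<lambda>k. left_span K {\<alpha> \<in> exponents n. (\<Sum>i\<in>{1..n}. \<alpha> i) = k} (monomial R n x))"
    by (rule left_span_grading[OF K _ monomial_basis]) (use monomial_carrier in blast)
  moreover have "PBW_component R K n x
      = (\<lambda>k. left_span K {\<alpha> \<in> exponents n. (\<Sum>i\<in>{1..n}. \<alpha> i) = k} (monomial R n x))"
    by (rule ext) (rule PBW_component_eq_left_span)
  ultimately show ?thesis by simp
qed

text \<open>Products of components need not lie in a single component, but \<open>A\<^sub>k\<close> lies in step
  \<open>k\<close> of the multiplicative filtration, and that step is contained in
  \<open>A\<^sub>0 + \<cdots> + A\<^sub>k\<close>.\<close>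
lemma PBW_component_semi_graded: "semi_graded R (PBW_component R K n x)"
proof -
  let ?B = "PBW_component R K n x"
  note sub = internal_direct_sum_subgroup[OF PBW_component_direct_sum]
  have B_F: "?B k \<subseteq> filtration k" for k
    unfolding PBW_component_eq_words filtration_def by (rule left_span_mono) auto
  have F_sum: "filtration k \<subseteq> sum_upto R ?B k" for k
  proof (rule filtration_minimal)
    fix w c assume w: "w \<in> sorted_words n" "length w \<le> k" and c: "c \<in> K"
    have "c \<otimes> word_product x w \<in> ?B (length w)"
      unfolding PBW_component_eq_words
      by (rule left_span_generator[OF K _ _ c]) (use w word_carrier in auto)
    then show "c \<otimes> word_product x w \<in> sum_upto R ?B k"
      using sum_upto_additive(4)[of ?B, OF sub w(2)] by blast
  qed (use sum_upto_additive[of ?B, OF sub] in auto)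
  have "?B k <#> ?B l \<subseteq> sum_upto R ?B (k + l)" for k l
  proof -
    have "a \<otimes> b \<in> sum_upto R ?B (k + l)" if "a \<in> ?B k" "b \<in> ?B l" for a b
      using filtration_mult[of a k b l] B_F F_sum that by blast
    then show ?thesis by (auto simp: set_mult_def)
  qed
  then show ?thesis
    using PBW_component_direct_sum PBW_component_0 subringE(3)[OF K] ring_axioms
    by (simp add: semi_graded_def)
qed

lemma generated_by_variables: "generate_ring R (K \<union> x ` {1..n}) = carrier R"
proof
  have sub: "K \<union> x ` {1..n} \<subseteq> carrier R" using subringE(1)[OF K] x_carrier by blast
  note G = subringE[OF generate_ring_is_subring[OF sub]]
  show "generate_ring R (K \<union> x ` {1..n}) \<subseteq> carrier R" by (rule G(1))
  have word: "word_product x w \<in> generate_ring R (K \<union> x ` {1..n})" if "w \<in> lists {1..n}" for w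
    using that
  proof induction
    case Nil
    show ?case using G(3) by simp
  next
    case (Cons i w)
    then have "x i \<in> generate_ring R (K \<union> x ` {1..n})" by (intro generate_ring.incl) blast
    then show ?case using G(6) Cons by simp
  qed
  have "left_span K (exponents n) (monomial R n x) \<subseteq> generate_ring R (K \<union> x ` {1..n})"
  proof (rule left_span_minimal)
    fix \<alpha> k assume k: "k \<in> K"
    have "monomial R n x \<alpha> \<in> generate_ring R (K \<union> x ` {1..n})"
      unfolding monomial_eq_word_product[OF x]
      by (rule word) (use exponent_word_sorted in \<open>auto simp: sorted_words_def\<close>)
    then show "k \<otimes> monomial R n x \<alpha> \<in> generate_ring R (K \<union> x ` {1..n})"
      using k by (intro G(6)) (auto intro: generate_ring.incl)
  qed (use G in auto)
  then show "carrier R \<subseteq> generate_ring R (K \<union> x ` {1..n})" unfolding monomial_basis(1) .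
qed

lemma PBW_component_finitely_semi_graded:
  assumes ibn: "invariant_basis_number (R\<lparr>carrier := K\<rparr>)"
  shows "finitely_semi_graded R (PBW_component R K n x)"
proof -
  have "\<exists>d. free_of_dim (R\<lparr>carrier := K\<rparr>) (mult_module R (PBW_component R K n x k)) d" for k
  proof
    let ?E = "{\<alpha> \<in> exponents n. (\<Sum>i\<in>{1..n}. \<alpha> i) = k}"
    show "free_of_dim (R\<lparr>carrier := K\<rparr>) (mult_module R (PBW_component R K n x k)) (card ?E)"
      unfolding PBW_component_eq_left_span
    proof (rule free_of_dim_invariant_basis_number[OF K ibn finite_exponents_of_degree])
      show "left_independent K ?E (monomial R n x)"
        by (rule left_independent_mono[OF monomial_basis(2)]) blast
    qed (use monomial_carrier in blast)
  qed
  moreover have "\<exists>X. finite X \<and> X \<subseteq> carrier R \<and> generate_ring R (K \<union> X) = carrier R"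
    by (intro exI[of _ "x ` {1..n}"]) (use generated_by_variables x_carrier in auto)
  ultimately show ?thesis
    unfolding finitely_semi_graded_def PBW_component_0
    using PBW_component_semi_graded by blast
qed

end

theorem proposition2p7:
  shows "(\<forall>(B :: ('a, 'r) ring_scheme) Bn. graded_ring B Bn \<longrightarrow> semi_graded B Bn) \<and>
    (\<forall>K (A :: ('b, 's) ring_scheme) An.
        finitely_graded_algebra K A An \<longrightarrow> finitely_semi_graded A An) \<and>
    (\<forall>(A :: ('c, 't) ring_scheme) R n x.
        invariant_basis_number (A\<lparr>carrier := R\<rparr>) \<and> skew_PBW_extension A R n x \<longrightarrow>
        finitely_semi_graded A (PBW_component A R n x))"
proof (intro conjI allI impI)
  show "semi_graded B Bn" if "graded_ring B Bn" for B :: "('a, 'r) ring_scheme" and Bn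
    by (rule ring.graded_ring_imp_semi_graded[OF _ that])
      (use that in \<open>simp add: graded_ring_def\<close>)
  show "finitely_semi_graded A An" if "finitely_graded_algebra K A An"
    for K and A :: "('b, 's) ring_scheme" and An
    by (rule ring.finitely_graded_algebra_imp_finitely_semi_graded[OF _ that])
      (use that in \<open>simp add: finitely_graded_algebra_def\<close>)
  show "finitely_semi_graded A (PBW_component A R n x)"
    if "invariant_basis_number (A\<lparr>carrier := R\<rparr>) \<and> skew_PBW_extension A R n x"
    for A :: "('c, 't) ring_scheme" and R n x
  proof (rule skew_PBW.PBW_component_finitely_semi_graded)
    show "skew_PBW A R n x"
      using that by (simp add: skew_PBW_def skew_PBW_axioms_def skew_PBW_extension_def)
  qed (use that in blast)
qed

end
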